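(* Let $K=\mathbb{C}[u_1,\dots,u_4]$ and let $A$ be the algebra over $K$ spanned by $\widetilde\phi_1,\dots,\widetilde\phi_4$, with the $K$-bilinear multiplication determined by $$\widetilde\phi_i*\widetilde\phi_j=\sum_{k=1}^4C_{ij}^k\,\widetilde\phi_k\qquad(i,j=1,\dots,4),$$ where the elements $\widetilde\phi_i$ and the structure constants $C_{ij}^k\in K$ are those given in the context. Then $A$ is associative.
   Context: Let $K=\mathbb{C}[u_1,u_2,u_3,u_4]$ and define $b_1,b_2,b_3,p,q\in K[x]$ by $b_1=-636x^9-300u_1x^7-48u_1^2x^5-5u_2x^3+2u_3x$, $b_2=-168x^{18}-348u_1x^{16}-276u_1^2x^{14}+(-116u_1^3+14u_2)x^{12}+(-92u_3-20u_1^4-8u_1u_2)x^{10}+(-42u_1u_3-6u_1^2u_2)x^8+(-4u_4-\frac{10}{3}u_1^2u_3-\frac23u_2^2)x^6+(\frac13u_2u_3-\frac23u_4u_1)x^4$, $b_3=x^{27}+6u_1x^{25}+15u_1^2x^{23}+(20u_1^3+u_2)x^{21}+(5u_3+4u_1u_2+15u_1^4)x^{19}+(6u_1^2u_2+12u_1u_3+6u_1^5)x^{17}+(\frac13u_2^2+5u_4+4u_1^3u_2+\frac{26}{3}u_1^2u_3+u_1^6)x^{15}+(\frac43u_1^3u_3+\frac{19}{3}u_4u_1+u_1^4u_2+\frac43u_2u_3+\frac23u_2^2u_1)x^{13}+(\frac13u_1^2u_2^2-\frac13u_1^4u_3-\frac{15}{4}u_3^2+3u_4u_1^2)x^{11}+(\frac13u_4u_2-\frac49u_1^2u_2u_3+\frac1{27}u_2^3-\frac{13}{6}u_3^2u_1+\frac{13}{27}u_4u_1^3)x^9+(-\frac19u_2^2u_3-\frac12u_4u_3+\frac19u_4u_1u_2-\frac7{36}u_1^2u_3^2)x^7+(\frac1{12}u_3^2u_2-\frac16u_4u_1u_3)x^5+(-\frac1{54}u_3^3-\frac1{108}u_4^2)x^3$,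 $p=-\frac{b_2}{6}-\frac{b_1^2}{144}$, $\quad q=\frac1{27}\left(\frac{b_1^3}{32}+\frac98b_1b_2+27b_3\right)$. The (pure $F_4$ Seiberg–Witten) curve is $z+\mu/z=W$ with $W=\frac{b_1}{24}-\frac1{2p}(a+b)$, where $c=\sqrt{q^2+4p^3}$, $a=p\left(\frac{-q+c}{2}\right)^{1/3}$, $b=p\left(\frac{-q-c}{2}\right)^{1/3}$, the cube roots being chosen so that $ab=-p^3$. Set $\phi_i=-\partial W/\partial u_i$, $\widetilde\phi_i=abc\,\phi_i$ and $\widetilde{\partial_xW}=abc\,\partial_xW$. Regarding $x,a,b,c$ as independent variables, $I\subset K[x,a,b,c]$ is the ideal generated by $$c^2-q^2-4p^3,\quad ab+p^3,\quad a^2-\tfrac12(q-c)b,\quad b^2-\tfrac12(q+c)a .$$ For a derivation $D\in\{\partial_{u_1},\dots,\partial_{u_4},\partial_x\}$ of $K[x]$ put $$F_D=-\tfrac1{24}\,abc\,D(b_1)+\tfrac16p^2D(q)(a-b)-\tfrac14\,p\,D(p)\big(a(q+c)+b(c-q)\big)\in K[x,a,b,c].$$ The elements $\widetilde\phi_i,\widetilde{\partial_xW}\in K[x,a,b,c]/I$ are the classes of $F_{\partial_{u_i}}$ and $-F_{\partial_x}$. The algebra $A$ is the 4-dimensional (free of rank 4 over $K$) algebra with basis $\widetilde\phi_1,\dots,\widetilde\phi_4$. The structure constants $C_{ij}^k\in K$ are those of the product relations $$\widetilde\phi_i\widetilde\phi_j=\sum_{k=1}^4C_{ij}^k\,\widetilde\phi_k\widetilde\phi_4+\widetilde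 Q_{ij}\,\widetilde{\partial_xW}\quad\text{in }K[x,a,b,c]/I,\qquad \widetilde Q_{ij}\in K[x,a,b,c]/I .$$ Explicitly, writing $M_i$ for the $4\times4$ matrix with entry $C_{ij}^k$ in row $k$ and column $j$, $M_4$ is the identity matrix and $$M_1=\begin{pmatrix} u_1\left(\frac{250}{243}u_1^4-\frac{10}{9}u_1u_2-\frac73u_3\right) & -\frac{25}{54}u_1^3+\frac14u_2 & -\frac53u_1^2 & 1\\ \frac{100}{81}u_1^4u_2+\frac{140}{27}u_1^3u_3-\frac23u_1u_2^2-\frac43u_1u_4-2u_2u_3 & u_1\left(-\frac59u_1u_2-\frac73u_3\right) & -6u_3-2u_1u_2 & 0\\ -\frac29u_1u_2u_3-\frac23u_3^2+\frac{100}{243}u_1^4u_3-\frac{10}{27}u_1^2u_4 & \frac16u_4-\frac5{27}u_1^2u_3 & -\frac23u_1u_3 & 0\\ \frac{10}9u_1^2u_3^2-\frac13u_1u_2u_4-u_3u_4+\frac{50}{81}u_1^4u_4 & -\frac12u_3^2-\frac5{18}u_1^2u_4 & -u_1u_4 & 0 \end{pmatrix},$$ $$M_2=\begin{pmatrix} -\frac{25}{54}u_1^3+\frac14u_2 & \frac5{24}u_1 & \frac34 & 0\\ u_1\left(-\frac59u_1u_2-\frac73u_3\right) & \frac14u_2 & 0 & 1\\ \frac16u_4-\frac5{27}u_1^2u_3 & \frac1{12}u_3 & 0 & 0\\ -\frac12u_3^2-\frac5{18}u_1^2u_4 & \frac18u_4 & 0 & 0 \end{pmatrix},\qquad M_3=\begin{pmatrix}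 -\frac53u_1^2 & \frac34 & 0 & 0\\ -6u_3-2u_1u_2 & 0 & -6u_1 & 0\\ -\frac23u_1u_3 & 0 & 0 & 1\\ -u_1u_4 & 0 & -\frac92u_3 & 0 \end{pmatrix}.$$ *)

theory Defs
  imports "HOL-Computational_Algebra.Computational_Algebra"
begin

text \<open>
  Polynomial rings in several variables are iterated univariate polynomial rings.
  \<open>K\<close> is \<open>\<complex>[u\<^sub>1][u\<^sub>2][u\<^sub>3][u\<^sub>4]\<close>, with \<open>u\<^sub>4\<close> the outermost variable,
  \<open>K poly\<close> is \<open>K[x]\<close>, and \<open>Kxabc\<close> is \<open>K[x][a][b][c]\<close>, with \<open>c\<close> the outermost variable.
\<close>

type_synonym K = "complex poly poly poly poly"
type_synonym Kx = "K poly"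
type_synonym Kxabc = "Kx poly poly poly"

definition constK :: "complex \<Rightarrow> K" where "constK r = [:[:[:[:r:]:]:]:]"

definition u1 :: K where "u1 = [:[:[:[:0, 1:]:]:]:]"
definition u2 :: K where "u2 = [:[:[:0, 1:]:]:]"
definition u3 :: K where "u3 = [:[:0, 1:]:]"
definition u4 :: K where "u4 = [:0, 1:]"

text \<open>
  The partial derivatives: \<open>pderiv\<close> differentiates with respect to the outermost variable,
  and \<open>map_poly\<close> lets a derivation of the coefficient ring act coefficientwise.
\<close>

definition DK :: "nat \<Rightarrow> K \<Rightarrow> K" where
  "DK i = (if i = 1 then map_poly (map_poly (map_poly pderiv))
           else if i = 2 then map_poly (map_poly pderiv)
           else if i = 3 then map_poly pderiv
           else pderiv)"

definition Du :: "nat \<Rightarrow> Kx \<Rightarrow> Kx" where "Du i = map_poly (DK i)"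
definition Dx :: "Kx \<Rightarrow> Kx" where "Dx = pderiv"

definition b1 :: Kx where
  "b1 = monom (-636) 9 + monom (-300 * u1) 7 + monom (-48 * u1^2) 5
      + monom (-5 * u2) 3 + monom (2 * u3) 1"

definition b2 :: Kx where
  "b2 = monom (-168) 18 + monom (-348 * u1) 16 + monom (-276 * u1^2) 14
      + monom (-116 * u1^3 + 14 * u2) 12
      + monom (-92 * u3 - 20 * u1^4 - 8 * u1 * u2) 10
      + monom (-42 * u1 * u3 - 6 * u1^2 * u2) 8
      + monom (-4 * u4 - constK (10/3) * u1^2 * u3 - constK (2/3) * u2^2) 6
      + monom (constK (1/3) * u2 * u3 - constK (2/3) * u4 * u1) 4"

definition b3 :: Kx where
  "b3 = monom 1 27 + monom (6 * u1) 25 + monom (15 * u1^2) 23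
      + monom (20 * u1^3 + u2) 21
      + monom (5 * u3 + 4 * u1 * u2 + 15 * u1^4) 19
      + monom (6 * u1^2 * u2 + 12 * u1 * u3 + 6 * u1^5) 17
      + monom (constK (1/3) * u2^2 + 5 * u4 + 4 * u1^3 * u2
               + constK (26/3) * u1^2 * u3 + u1^6) 15
      + monom (constK (4/3) * u1^3 * u3 + constK (19/3) * u4 * u1 + u1^4 * u2
               + constK (4/3) * u2 * u3 + constK (2/3) * u2^2 * u1) 13
      + monom (constK (1/3) * u1^2 * u2^2 - constK (1/3) * u1^4 * u3
               - constK (15/4) * u3^2 + 3 * u4 * u1^2) 11
      + monom (constK (1/3) * u4 * u2 - constK (4/9) * u1^2 * u2 * u3
               + constK (1/27) * u2^3 - constK (13/6) * u3^2 * u1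
               + constK (13/27) * u4 * u1^3) 9
      + monom (- constK (1/9) * u2^2 * u3 - constK (1/2) * u4 * u3
               + constK (1/9) * u4 * u1 * u2 - constK (7/36) * u1^2 * u3^2) 7
      + monom (constK (1/12) * u3^2 * u2 - constK (1/6) * u4 * u1 * u3) 5
      + monom (- constK (1/54) * u3^3 - constK (1/108) * u4^2) 3"

definition pF :: Kx where
  "pF = - smult (constK (1/6)) b2 - smult (constK (1/144)) (b1^2)"

definition qF :: Kx where
  "qF = smult (constK (1/27))
         (smult (constK (1/32)) (b1^3) + smult (constK (9/8)) (b1 * b2) + 27 * b3)"

definition constx :: "Kx \<Rightarrow> Kxabc" where "constx f = [:[:[:f:]:]:]"
definition constP :: "complex \<Rightarrow> Kxabc" where "constP r = constx [:constK r:]"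

definition va :: Kxabc where "va = [:[:[:0, 1:]:]:]"
definition vb :: Kxabc where "vb = [:[:0, 1:]:]"
definition vc :: Kxabc where "vc = [:0, 1:]"

text \<open>The ideal generated by a set is its span over the ring itself.\<close>

definition I_ideal :: "Kxabc set" where
  "I_ideal = module.span (*)
     {vc^2 - constx qF ^ 2 - 4 * constx pF ^ 3,
      va * vb + constx pF ^ 3,
      va^2 - constP (1/2) * (constx qF - vc) * vb,
      vb^2 - constP (1/2) * (constx qF + vc) * va}"

interpretation Kxabc: module "(*) :: Kxabc \<Rightarrow> Kxabc \<Rightarrow> Kxabc"
  by unfold_locales (auto simp: algebra_simps)

lemma I_ideal_0: "0 \<in> I_ideal"
  and I_ideal_add: "f \<in> I_ideal \<Longrightarrow> g \<in> I_ideal \<Longrightarrow> f + g \<in> I_ideal"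
  and I_ideal_diff: "f \<in> I_ideal \<Longrightarrow> g \<in> I_ideal \<Longrightarrow> f - g \<in> I_ideal"
  and I_ideal_neg: "f \<in> I_ideal \<Longrightarrow> - f \<in> I_ideal"
  and I_ideal_mult: "f \<in> I_ideal \<Longrightarrow> h * f \<in> I_ideal"
  unfolding I_ideal_def
  by (auto intro: Kxabc.span_zero Kxabc.span_add Kxabc.span_diff Kxabc.span_neg Kxabc.span_scale)

definition I_eq :: "Kxabc \<Rightarrow> Kxabc \<Rightarrow> bool" where "I_eq f g \<longleftrightarrow> f - g \<in> I_ideal"

lemma I_eq_equivp: "equivp I_eq"
proof (rule equivpI)
  show "reflp I_eq" by (rule reflpI) (simp add: I_eq_def I_ideal_0)
  show "symp I_eq"
    by (rule sympI) (use I_ideal_neg in \<open>force simp: I_eq_def\<close>)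
  show "transp I_eq"
    by (rule transpI) (use I_ideal_add in \<open>force simp: I_eq_def\<close>)
qed

quotient_type sw_ring = Kxabc / I_eq
  morphisms rep_sw_ring cls
  by (rule I_eq_equivp)

lemma one_notin_I_ideal: "1 \<notin> I_ideal"
proof
  assume "1 \<in> I_ideal"
  define ev :: "Kxabc \<Rightarrow> K" where "ev f = poly (poly (poly (poly f 0) 0) 0) 0" for f
  have b0: "poly b1 0 = 0" "poly b2 0 = 0" "poly b3 0 = 0"
    by (simp_all only: b1_def b2_def b3_def poly_add poly_monom) simp_all
  have pq: "poly pF 0 = 0" "poly qF 0 = 0"
    by (simp_all only: pF_def qF_def b0 poly_add poly_diff poly_minus poly_smult poly_power poly_mult)
       simp_all
  have hom: "ev (f + g) = ev f + ev g" "ev (f - g) = ev f - ev g" "ev (f * g) = ev f * ev g"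
    "ev (f ^ n) = ev f ^ n" for f g n
    by (simp_all only: ev_def poly_add poly_diff poly_mult poly_power)
  have ev0: "ev 0 = 0" and ev1: "ev 1 = 1"
    by (simp_all only: ev_def poly_0 poly_1)
  have gen: "ev vc = 0" "ev vb = 0" "ev va = 0" "ev (constx pF) = 0" "ev (constx qF) = 0"
    by (simp_all add: ev_def va_def vb_def vc_def constx_def pq)
  have gens0: "ev g = 0" if "g \<in> {vc^2 - constx qF ^ 2 - 4 * constx pF ^ 3,
      va * vb + constx pF ^ 3,
      va^2 - constP (1/2) * (constx qF - vc) * vb,
      vb^2 - constP (1/2) * (constx qF + vc) * va}" for g
    using that by (elim insertE emptyE; hypsubst) (simp_all only: hom gen, simp_all)
  have "ev f = 0" if "f \<in> I_ideal" for f
    using that unfolding I_ideal_def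
    by (induction rule: Kxabc.span_induct_alt) (simp_all only: hom ev0 gens0, simp)
  from this[OF \<open>1 \<in> I_ideal\<close>] show False by (simp only: ev1 one_neq_zero)
qed

lemma I_eqI: "f = g \<Longrightarrow> I_eq f g"
  by (simp only: I_eq_def diff_self I_ideal_0)

instantiation sw_ring :: comm_ring_1
begin

lift_definition zero_sw_ring :: sw_ring is 0 .
lift_definition one_sw_ring :: sw_ring is 1 .
lift_definition plus_sw_ring :: "sw_ring \<Rightarrow> sw_ring \<Rightarrow> sw_ring" is "(+)"
  unfolding I_eq_def by (metis I_ideal_add add_diff_add)
lift_definition minus_sw_ring :: "sw_ring \<Rightarrow> sw_ring \<Rightarrow> sw_ring" is "(-)"
  unfolding I_eq_def by (metis (no_types, lifting) I_ideal_diff diff_diff_eq2 diff_add_eq diff_diff_add add.commute)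
lift_definition uminus_sw_ring :: "sw_ring \<Rightarrow> sw_ring" is uminus
  unfolding I_eq_def by (metis I_ideal_neg minus_diff_minus)
lift_definition times_sw_ring :: "sw_ring \<Rightarrow> sw_ring \<Rightarrow> sw_ring" is "(*)"
proof -
  fix f f' g g' :: Kxabc
  assume "I_eq f f'" "I_eq g g'"
  then have "g * (f - f') + f' * (g - g') \<in> I_ideal"
    unfolding I_eq_def by (intro I_ideal_add I_ideal_mult)
  then show "I_eq (f * g) (f' * g')"
    by (simp add: I_eq_def algebra_simps)
qed

instance
proof
  fix x y z :: sw_ring
  show "x * y * z = x * (y * z)" by transfer (rule I_eqI, rule mult.assoc)
  show "x * y = y * x" by transfer (rule I_eqI, rule mult.commute)
  show "1 * x = x" by transfer (rule I_eqI, rule mult_1_left)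
  show "(x + y) * z = x * z + y * z" by transfer (rule I_eqI, rule distrib_right)
  show "x + y + z = x + (y + z)" by transfer (rule I_eqI, rule add.assoc)
  show "x + y = y + x" by transfer (rule I_eqI, rule add.commute)
  show "0 + x = x" by transfer (rule I_eqI, rule add_0_left)
  show "- x + x = 0" by transfer (rule I_eqI, rule left_minus)
  show "x - y = x + - y" by transfer (rule I_eqI, rule diff_conv_add_uminus)
  show "(0::sw_ring) \<noteq> 1"
  proof (transfer, rule notI)
    assume "I_eq 0 1"
    then have "- (0 - 1) \<in> I_ideal" unfolding I_eq_def by (rule I_ideal_neg)
    then show False using one_notin_I_ideal by (simp only: minus_diff_eq diff_0_right)
  qed
qed

end

definition scaleK :: "K \<Rightarrow> sw_ring \<Rightarrow> sw_ring" (infixr \<open>*\<^sub>K\<close> 75) where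
  "k *\<^sub>K r = cls (constx [:k:]) * r"

definition F_elt :: "(Kx \<Rightarrow> Kx) \<Rightarrow> Kxabc" where
  "F_elt D =
     - constP (1/24) * va * vb * vc * constx (D b1)
     + constP (1/6) * constx pF ^ 2 * constx (D qF) * (va - vb)
     - constP (1/4) * constx pF * constx (D pF) *
         (va * (constx qF + vc) + vb * (vc - constx qF))"

definition phi :: "nat \<Rightarrow> sw_ring" where "phi i = cls (F_elt (Du i))"
definition dxW :: sw_ring where "dxW = cls (- F_elt Dx)"

definition M1 :: "K list list" where
  "M1 =
    [[u1 * (constK (250/243) * u1^4 - constK (10/9) * u1 * u2 - constK (7/3) * u3),
      - constK (25/54) * u1^3 + constK (1/4) * u2,
      - constK (5/3) * u1^2,
      1],
     [constK (100/81) * u1^4 * u2 + constK (140/27) * u1^3 * u3 - constK (2/3) * u1 * u2^2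
        - constK (4/3) * u1 * u4 - 2 * u2 * u3,
      u1 * (- constK (5/9) * u1 * u2 - constK (7/3) * u3),
      - 6 * u3 - 2 * u1 * u2,
      0],
     [- constK (2/9) * u1 * u2 * u3 - constK (2/3) * u3^2 + constK (100/243) * u1^4 * u3
        - constK (10/27) * u1^2 * u4,
      constK (1/6) * u4 - constK (5/27) * u1^2 * u3,
      - constK (2/3) * u1 * u3,
      0],
     [constK (10/9) * u1^2 * u3^2 - constK (1/3) * u1 * u2 * u4 - u3 * u4
        + constK (50/81) * u1^4 * u4,
      - constK (1/2) * u3^2 - constK (5/18) * u1^2 * u4,
      - u1 * u4,
      0]]"

definition M2 :: "K list list" where
  "M2 =
    [[- constK (25/54) * u1^3 + constK (1/4) * u2, constK (5/24) * u1, constK (3/4), 0],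
     [u1 * (- constK (5/9) * u1 * u2 - constK (7/3) * u3), constK (1/4) * u2, 0, 1],
     [constK (1/6) * u4 - constK (5/27) * u1^2 * u3, constK (1/12) * u3, 0, 0],
     [- constK (1/2) * u3^2 - constK (5/18) * u1^2 * u4, constK (1/8) * u4, 0, 0]]"

definition M3 :: "K list list" where
  "M3 =
    [[- constK (5/3) * u1^2, constK (3/4), 0, 0],
     [- 6 * u3 - 2 * u1 * u2, 0, - 6 * u1, 0],
     [- constK (2/3) * u1 * u3, 0, 0, 1],
     [- u1 * u4, 0, - constK (9/2) * u3, 0]]"

definition M4 :: "K list list" where
  "M4 = [[1, 0, 0, 0], [0, 1, 0, 0], [0, 0, 1, 0], [0, 0, 0, 1]]"

text \<open>\<open>struct_C i j k\<close> is \<open>C\<^sub>i\<^sub>j\<^sup>k\<close>, the entry of \<open>M\<^sub>i\<close> in row \<open>k\<close> and column \<open>j\<close>,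
  for indices in \<open>{1..4}\<close>.\<close>

definition struct_C :: "nat \<Rightarrow> nat \<Rightarrow> nat \<Rightarrow> K" where
  "struct_C i j k = [M1, M2, M3, M4] ! (i - 1) ! (k - 1) ! (j - 1)"

lemma cls_eq_iff: "cls f = cls g \<longleftrightarrow> f - g \<in> I_ideal"
  using sw_ring.abs_eq_iff[of f g] by (simp only: I_eq_def)

lemma cls_hom:
  "cls (f + g) = cls f + cls g" "cls (f - g) = cls f - cls g" "cls (f * g) = cls f * cls g"
  "cls (- f) = - cls f" "cls 0 = 0" "cls 1 = 1"
  by (rule plus_sw_ring.abs_eq[symmetric] minus_sw_ring.abs_eq[symmetric]
      times_sw_ring.abs_eq[symmetric] uminus_sw_ring.abs_eq[symmetric]
      zero_sw_ring.abs_eq[symmetric] one_sw_ring.abs_eq[symmetric])+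

lemma constx_hom:
  "constx (f + g) = constx f + constx g" "constx (f - g) = constx f - constx g"
  "constx (f * g) = constx f * constx g" "constx (- f) = - constx f"
  "constx 0 = 0" "constx 1 = 1"
  by (simp_all add: constx_def one_pCons)

lemma const_poly_hom:
  fixes k l :: "'a::comm_ring_1"
  shows "[:k + l:] = [:k:] + [:l:]" "[:k - l:] = [:k:] - [:l:]" "[:k * l:] = [:k:] * [:l:]"
  by simp_all

global_interpretation SW: module scaleK
  defines SW_span = SW.span
    and SW_representation = SW.representation
    and SW_dependent = SW.dependent
  by unfold_locales
    (simp_all only: scaleK_def const_poly_hom constx_hom cls_hom distrib_left distrib_right
       mult.assoc pCons_one mult_1_left)

text \<open>\<open>A_mult\<close> is the \<open>K\<close>-bilinear product on \<open>A_carrier\<close> that is given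
  on the basis by the structure constants; \<open>coord v i\<close> is the coordinate of \<open>v\<close> at the
  basis vector \<open>phi i\<close>.\<close>

definition A_carrier :: "sw_ring set" where "A_carrier = SW_span (phi ` {1..4})"

definition coord :: "sw_ring \<Rightarrow> nat \<Rightarrow> K" where
  "coord v i = SW_representation (phi ` {1..4}) v (phi i)"

definition A_mult :: "sw_ring \<Rightarrow> sw_ring \<Rightarrow> sw_ring" where
  "A_mult v w = (\<Sum>i\<in>{1..4}. \<Sum>j\<in>{1..4}.
     (coord v i * coord w j) *\<^sub>K (\<Sum>k\<in>{1..4}. struct_C i j k *\<^sub>K phi k))"

text \<open>
  The remaining facts show that these definitions are the intended ones: \<open>phi 1, \<dots>, phi 4\<close>
  are linearly independent over \<open>K\<close> (\<open>inj_on_phi\<close>, \<open>phi_independent\<close>), so \<open>A_carrier\<close> is free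
  of rank 4 and \<open>A_mult\<close> is indeed the \<open>K\<close>-bilinear product with the prescribed values
  (\<open>A_mult_phi\<close>, \<open>A_mult_bilinear\<close>), and the explicit \<open>struct_C\<close> satisfy the relations
  \<open>phi i * phi j = (\<Sum>k. struct_C i j k *\<^sub>K (phi k * phi 4)) + Q * dxW\<close> in \<open>K[x,a,b,c]/I\<close>
  (\<open>product_relations\<close>).
\<close>

definition is_derivation :: "('a::comm_ring_1 \<Rightarrow> 'a) \<Rightarrow> bool" where
  "is_derivation D \<longleftrightarrow> (\<forall>f g. D (f + g) = D f + D g) \<and> (\<forall>f g. D (f * g) = f * D g + D f * g)"

lemma is_derivation_pderiv: "is_derivation (pderiv :: 'a::idom poly \<Rightarrow> _)"
  by (simp add: is_derivation_def pderiv_add pderiv_mult mult.commute)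

context
  fixes D :: "'a::comm_ring_1 \<Rightarrow> 'a"
  assumes D: "is_derivation D"
begin

lemma deriv_add: "D (f + g) = D f + D g"
  using D by (simp add: is_derivation_def)

lemma deriv_mult: "D (f * g) = f * D g + D f * g"
  using D by (simp add: is_derivation_def)

lemma deriv_0: "D 0 = 0"
  using deriv_add[of 0 0] by simp

lemma deriv_1: "D 1 = 0"
  using deriv_mult[of 1 1] by simp

lemma deriv_minus: "D (- f) = - D f"
  using deriv_add[of f "- f"] by (simp add: deriv_0 minus_unique)

lemma deriv_diff: "D (f - g) = D f - D g"
  using deriv_add[of f "- g"] by (simp add: deriv_minus)

lemma deriv_of_nat: "D (of_nat n) = 0"
  by (induction n) (simp_all add: deriv_0 deriv_1 deriv_add)

lemma deriv_numeral: "D (numeral n) = 0"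
  using deriv_of_nat[of "numeral n"] by simp

lemma deriv_power: "D (f ^ n) = of_nat n * f ^ (n - 1) * D f"
proof (induction n)
  case (Suc n)
  then show ?case
    by (cases n) (simp_all add: deriv_mult algebra_simps)
qed (simp add: deriv_1)

lemma deriv_sum: "D (sum f S) = (\<Sum>i\<in>S. D (f i))"
  by (induction S rule: infinite_finite_induct) (simp_all add: deriv_0 deriv_add)

lemma is_derivation_map_poly: "is_derivation (map_poly D)"
  unfolding is_derivation_def
proof (intro conjI allI)
  fix f g :: "'a poly"
  show "map_poly D (f + g) = map_poly D f + map_poly D g"
    by (rule poly_eqI) (simp add: coeff_map_poly deriv_0 deriv_add)
  show "map_poly D (f * g) = f * map_poly D g + map_poly D f * g"
    by (rule poly_eqI)
      (simp add: coeff_map_poly deriv_0 coeff_mult deriv_sum deriv_mult sum.distrib)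
qed

lemma map_poly_deriv_monom: "map_poly D (monom k n) = monom (D k) n"
  by (rule map_poly_monom) (rule deriv_0)

lemma map_poly_deriv_const: "map_poly D [:k:] = [:D k:]"
  by (simp add: map_poly_pCons deriv_0)

end

lemma is_derivation_DK: "is_derivation (DK i)"
  unfolding DK_def by (auto intro: is_derivation_map_poly is_derivation_pderiv)

lemma is_derivation_Du: "is_derivation (Du i)"
  unfolding Du_def by (rule is_derivation_map_poly[OF is_derivation_DK])

lemma is_derivation_Dx: "is_derivation Dx"
  unfolding Dx_def by (rule is_derivation_pderiv)

lemma DK_constK: "DK i (constK r) = 0"
  by (simp add: DK_def constK_def map_poly_pCons pderiv_pCons)

lemma DK_u:
  "DK i u1 = (if i = 1 then 1 else 0)"
  "DK i u2 = (if i = 2 then 1 else 0)"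
  "DK i u3 = (if i = 3 then 1 else 0)"
  "i \<in> {1..4} \<Longrightarrow> DK i u4 = (if i = 4 then 1 else 0)"
  by (auto simp: DK_def u1_def u2_def u3_def u4_def map_poly_pCons pderiv_pCons one_pCons)

lemmas DK_simps = deriv_add[OF is_derivation_DK] deriv_mult[OF is_derivation_DK]
  deriv_0[OF is_derivation_DK] deriv_1[OF is_derivation_DK] deriv_minus[OF is_derivation_DK]
  deriv_diff[OF is_derivation_DK] deriv_numeral[OF is_derivation_DK]
  deriv_power[OF is_derivation_DK] DK_constK DK_u

lemma Du_monom: "Du i (monom k n) = monom (DK i k) n"
  unfolding Du_def by (rule map_poly_deriv_monom[OF is_derivation_DK])

lemma Du_const: "Du i [:k:] = [:DK i k:]"
  unfolding Du_def by (rule map_poly_deriv_const[OF is_derivation_DK])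

lemma Du_constK: "Du i [:constK r:] = 0"
  by (simp add: Du_const DK_constK)

lemma Dx_constK: "Dx [:constK r:] = 0"
  by (simp add: Dx_def pderiv_pCons)

definition evK :: "complex \<Rightarrow> complex \<Rightarrow> complex \<Rightarrow> complex \<Rightarrow> K \<Rightarrow> complex" where
  "evK v1 v2 v3 v4 k = poly (poly (poly (poly k [:[:[:v4:]:]:]) [:[:v3:]:]) [:v2:]) v1"

lemma evK_simps:
  "evK v1 v2 v3 v4 (k + l) = evK v1 v2 v3 v4 k + evK v1 v2 v3 v4 l"
  "evK v1 v2 v3 v4 (k - l) = evK v1 v2 v3 v4 k - evK v1 v2 v3 v4 l"
  "evK v1 v2 v3 v4 (k * l) = evK v1 v2 v3 v4 k * evK v1 v2 v3 v4 l"
  "evK v1 v2 v3 v4 (- k) = - evK v1 v2 v3 v4 k"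
  "evK v1 v2 v3 v4 (k ^ n) = evK v1 v2 v3 v4 k ^ n"
  "evK v1 v2 v3 v4 0 = 0"
  "evK v1 v2 v3 v4 1 = 1"
  "evK v1 v2 v3 v4 (constK r) = r"
  "evK v1 v2 v3 v4 u1 = v1" "evK v1 v2 v3 v4 u2 = v2" "evK v1 v2 v3 v4 u3 = v3"
  "evK v1 v2 v3 v4 u4 = v4"
  by (simp_all add: evK_def constK_def u1_def u2_def u3_def u4_def)

lemma evK_of_nat: "evK v1 v2 v3 v4 (of_nat n) = of_nat n"
  by (induction n) (simp_all add: evK_simps)

lemma evK_numeral: "evK v1 v2 v3 v4 (numeral n) = numeral n"
  using evK_of_nat[of v1 v2 v3 v4 "numeral n"] by simp

definition evx :: "complex \<Rightarrow> complex \<Rightarrow> complex \<Rightarrow> complex \<Rightarrow> complex \<Rightarrow> Kx \<Rightarrow> complex" where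
  "evx v1 v2 v3 v4 x f = evK v1 v2 v3 v4 (poly f (constK x))"

lemma evx_hom:
  "evx v1 v2 v3 v4 x (f + g) = evx v1 v2 v3 v4 x f + evx v1 v2 v3 v4 x g"
  "evx v1 v2 v3 v4 x (f - g) = evx v1 v2 v3 v4 x f - evx v1 v2 v3 v4 x g"
  "evx v1 v2 v3 v4 x (f * g) = evx v1 v2 v3 v4 x f * evx v1 v2 v3 v4 x g"
  "evx v1 v2 v3 v4 x (- f) = - evx v1 v2 v3 v4 x f"
  "evx v1 v2 v3 v4 x (f ^ n) = evx v1 v2 v3 v4 x f ^ n"
  "evx v1 v2 v3 v4 x 0 = 0"
  "evx v1 v2 v3 v4 x 1 = 1"
  "evx v1 v2 v3 v4 x (monom k n) = evK v1 v2 v3 v4 k * x ^ n"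
  "evx v1 v2 v3 v4 x (smult k f) = evK v1 v2 v3 v4 k * evx v1 v2 v3 v4 x f"
  "evx v1 v2 v3 v4 x [:k:] = evK v1 v2 v3 v4 k"
  by (simp_all only: evx_def poly_add poly_diff poly_mult poly_minus poly_power poly_0 poly_1
      poly_monom poly_smult evK_simps) (simp add: evK_simps)

lemma evx_of_nat: "evx v1 v2 v3 v4 x (of_nat n) = of_nat n"
  by (induction n) (simp_all only: of_nat_0 of_nat_Suc evx_hom)

lemma evx_numeral: "evx v1 v2 v3 v4 x (numeral n) = numeral n"
  using evx_of_nat[of v1 v2 v3 v4 x "numeral n"] by (simp only: of_nat_numeral)

lemma poly_eq_0_on_infinite:
  fixes f :: "'a::idom poly"
  assumes "infinite S" "\<And>x. x \<in> S \<Longrightarrow> poly f x = 0"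
  shows "f = 0"
proof (rule ccontr)
  assume "f \<noteq> 0"
  then have "finite {x. poly f x = 0}" by (rule poly_roots_finite)
  moreover have "S \<subseteq> {x. poly f x = 0}" using assms(2) by auto
  ultimately show False using assms(1) finite_subset by blast
qed

lemma infinite_range_inj: "inj (f :: complex \<Rightarrow> 'a) \<Longrightarrow> infinite (range f)"
  using finite_imageD infinite_UNIV_char_0 by blast

lemma evK_eq_0:
  assumes "\<And>v1 v2 v3 v4. evK v1 v2 v3 v4 k = 0"
  shows "k = 0"
proof (rule poly_eq_0_on_infinite)
  show "infinite (range (\<lambda>v4::complex. [:[:[:v4:]:]:]))"
    by (rule infinite_range_inj) (simp add: inj_def)
  fix w assume "w \<in> range (\<lambda>v4::complex. [:[:[:v4:]:]:])"
  then obtain v4 where w: "w = [:[:[:v4:]:]:]" by blast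
  show "poly k w = 0"
  proof (rule poly_eq_0_on_infinite)
    show "infinite (range (\<lambda>v3::complex. [:[:v3:]:]))"
      by (rule infinite_range_inj) (simp add: inj_def)
    fix w' assume "w' \<in> range (\<lambda>v3::complex. [:[:v3:]:])"
    then obtain v3 where w': "w' = [:[:v3:]:]" by blast
    show "poly (poly k w) w' = 0"
    proof (rule poly_eq_0_on_infinite)
      show "infinite (range (\<lambda>v2::complex. [:v2:]))"
        by (rule infinite_range_inj) (simp add: inj_def)
      fix w'' assume "w'' \<in> range (\<lambda>v2::complex. [:v2:])"
      then obtain v2 where w'': "w'' = [:v2:]" by blast
      show "poly (poly (poly k w) w') w'' = 0"
        by (rule poly_eq_0_on_infinite[OF infinite_UNIV_char_0])
          (use assms in \<open>simp add: evK_def w w' w''\<close>)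
    qed
  qed
qed

lemma evx_eq_0:
  assumes "\<And>v1 v2 v3 v4 x. evx v1 v2 v3 v4 x f = 0"
  shows "f = 0"
proof (rule poly_eq_0_on_infinite)
  show "infinite (range constK)"
    by (rule infinite_range_inj) (simp add: inj_def constK_def)
  fix w assume "w \<in> range constK"
  then show "poly f w = 0"
    using assms unfolding evx_def by (auto intro: evK_eq_0)
qed

lemma evx_eqI:
  assumes "\<And>v1 v2 v3 v4 x. evx v1 v2 v3 v4 x f = evx v1 v2 v3 v4 x g"
  shows "f = g"
  using evx_eq_0[of "f - g"] assms by (simp only: evx_hom diff_self) (simp add: evx_hom)

definition B1 :: Kx where "B1 = [:constK (1/12):] * b1"
definition B2 :: Kx where "B2 = [:constK (1/6):] * b2"

definition prod_identity :: "nat \<Rightarrow> nat \<Rightarrow> Kx \<Rightarrow> Kx \<Rightarrow> Kx \<Rightarrow> bool" where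
  "prod_identity i j Q0 Q1 Q2 \<longleftrightarrow>
    (let S = (\<lambda>f g. f i * g j - (\<Sum>k\<in>{1..4}. [:struct_C i j k:] * f k * g 4));
         \<alpha> = (\<lambda>k. Du k B1); \<beta> = (\<lambda>k. Du k B2); \<gamma> = (\<lambda>k. Du k b3);
         N1 = 9 * S \<alpha> \<alpha> + 3 * Q2 * Dx B1;
         N0 = 9 * (S \<alpha> \<beta> + S \<beta> \<alpha>) + 3 * Q2 * Dx B2 + 3 * Q1 * Dx B1 + 3 * B1 * N1
     in 3 * (S \<alpha> \<gamma> + S \<gamma> \<alpha>) + 9 * S \<beta> \<beta> + Q2 * Dx b3 + 3 * Q1 * Dx B2 + 3 * Q0 * Dx B1
          = - 3 * B1 * N0 - 3 * B2 * N1 \<and>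
        3 * (S \<beta> \<gamma> + S \<gamma> \<beta>) + Q1 * Dx b3 + 3 * Q0 * Dx B2 = - 3 * B2 * N0 - b3 * N1 \<and>
        S \<gamma> \<gamma> + Q0 * Dx b3 = - b3 * N0)"

lemma Du_B: "Du i B1 = [:constK (1/12):] * Du i b1" "Du i B2 = [:constK (1/6):] * Du i b2"
  by (simp_all only: B1_def B2_def deriv_mult[OF is_derivation_Du] Du_constK mult_zero_left add_0_right)
lemma Dx_B: "Dx B1 = [:constK (1/12):] * Dx b1" "Dx B2 = [:constK (1/6):] * Dx b2"
  by (simp_all only: B1_def B2_def deriv_mult[OF is_derivation_Dx] Dx_constK mult_zero_left add_0_right)
lemma Dx_monom: "Dx (monom k n) = monom (of_nat n * k) (n - 1)"
  by (simp add: Dx_def pderiv_monom)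

lemmas ev_simps = evx_hom evK_simps evK_of_nat evK_numeral evx_numeral

lemma ev_b1: "evx v1 v2 v3 v4 x b1 = (-636)*x^9 + (-300)*x^7*v1 + (-48)*x^5*v1^2 + (-5)*x^3*v2 + (2)*x*v3"
  by (simp only: b1_def ev_simps) (simp add: field_simps)

lemma ev_D1b1: "evx v1 v2 v3 v4 x (Du 1 b1) = (-300)*x^7 + (-96)*x^5*v1"
  by (simp only: b1_def deriv_add[OF is_derivation_Du] Du_monom DK_simps ev_simps) (simp add: DK_simps ev_simps field_simps eval_nat_numeral)

lemma ev_D2b1: "evx v1 v2 v3 v4 x (Du 2 b1) = (-5)*x^3"
  by (simp only: b1_def deriv_add[OF is_derivation_Du] Du_monom DK_simps ev_simps) (simp add: DK_simps ev_simps field_simps eval_nat_numeral)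

lemma ev_D3b1: "evx v1 v2 v3 v4 x (Du 3 b1) = (2)*x"
  by (simp only: b1_def deriv_add[OF is_derivation_Du] Du_monom DK_simps ev_simps) (simp add: DK_simps ev_simps field_simps eval_nat_numeral)

lemma ev_D4b1: "evx v1 v2 v3 v4 x (Du 4 b1) = 0"
  by (simp only: b1_def deriv_add[OF is_derivation_Du] Du_monom DK_simps ev_simps) (simp add: DK_simps ev_simps field_simps eval_nat_numeral)

lemma ev_Dxb1: "evx v1 v2 v3 v4 x (Dx b1) = (-5724)*x^8 + (-2100)*x^6*v1 + (-240)*x^4*v1^2 + (-15)*x^2*v2 + (2)*v3"
  by (simp only: b1_def deriv_add[OF is_derivation_Dx] Dx_monom ev_simps) (simp add: ev_simps field_simps)

lemma ev_b2: "evx v1 v2 v3 v4 x b2 = (-168)*x^18 + (-348)*x^16*v1 + (-276)*x^14*v1^2 + (-116)*x^12*v1^3 + (14)*x^12*v2 + (-20)*x^10*v1^4 + (-8)*x^10*v1*v2 + (-92)*x^10*v3 + (-6)*x^8*v1^2*v2 + (-42)*x^8*v1*v3 + (-10/3)*x^6*v1^2*v3 + (-2/3)*x^6*v2^2 + (-4)*x^6*v4 + (-2/3)*x^4*v1*v4 + (1/3)*x^4*v2*v3"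
  by (simp only: b2_def ev_simps) (simp add: field_simps)

lemma ev_D1b2: "evx v1 v2 v3 v4 x (Du 1 b2) = (-348)*x^16 + (-552)*x^14*v1 + (-348)*x^12*v1^2 + (-80)*x^10*v1^3 + (-8)*x^10*v2 + (-12)*x^8*v1*v2 + (-42)*x^8*v3 + (-20/3)*x^6*v1*v3 + (-2/3)*x^4*v4"
  by (simp only: b2_def deriv_add[OF is_derivation_Du] Du_monom DK_simps ev_simps) (simp add: DK_simps ev_simps field_simps eval_nat_numeral)

lemma ev_D2b2: "evx v1 v2 v3 v4 x (Du 2 b2) = (14)*x^12 + (-8)*x^10*v1 + (-6)*x^8*v1^2 + (-4/3)*x^6*v2 + (1/3)*x^4*v3"
  by (simp only: b2_def deriv_add[OF is_derivation_Du] Du_monom DK_simps ev_simps) (simp add: DK_simps ev_simps field_simps eval_nat_numeral)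

lemma ev_D3b2: "evx v1 v2 v3 v4 x (Du 3 b2) = (-92)*x^10 + (-42)*x^8*v1 + (-10/3)*x^6*v1^2 + (1/3)*x^4*v2"
  by (simp only: b2_def deriv_add[OF is_derivation_Du] Du_monom DK_simps ev_simps) (simp add: DK_simps ev_simps field_simps eval_nat_numeral)

lemma ev_D4b2: "evx v1 v2 v3 v4 x (Du 4 b2) = (-4)*x^6 + (-2/3)*x^4*v1"
  by (simp only: b2_def deriv_add[OF is_derivation_Du] Du_monom DK_simps ev_simps) (simp add: DK_simps ev_simps field_simps eval_nat_numeral)

lemma ev_Dxb2: "evx v1 v2 v3 v4 x (Dx b2) = (-3024)*x^17 + (-5568)*x^15*v1 + (-3864)*x^13*v1^2 + (-1392)*x^11*v1^3 + (168)*x^11*v2 + (-200)*x^9*v1^4 + (-80)*x^9*v1*v2 + (-920)*x^9*v3 + (-48)*x^7*v1^2*v2 + (-336)*x^7*v1*v3 + (-20)*x^5*v1^2*v3 + (-4)*x^5*v2^2 + (-24)*x^5*v4 + (-8/3)*x^3*v1*v4 + (4/3)*x^3*v2*v3"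
  by (simp only: b2_def deriv_add[OF is_derivation_Dx] Dx_monom ev_simps) (simp add: ev_simps field_simps)

lemma ev_b3: "evx v1 v2 v3 v4 x b3 = (1)*x^27 + (6)*x^25*v1 + (15)*x^23*v1^2 + (20)*x^21*v1^3 + (1)*x^21*v2 + (15)*x^19*v1^4 + (4)*x^19*v1*v2 + (5)*x^19*v3 + (6)*x^17*v1^5 + (6)*x^17*v1^2*v2 + (12)*x^17*v1*v3 + (1)*x^15*v1^6 + (4)*x^15*v1^3*v2 + (26/3)*x^15*v1^2*v3 + (1/3)*x^15*v2^2 + (5)*x^15*v4 + (1)*x^13*v1^4*v2 + (4/3)*x^13*v1^3*v3 + (2/3)*x^13*v1*v2^2 + (19/3)*x^13*v1*v4 + (4/3)*x^13*v2*v3 + (-1/3)*x^11*v1^4*v3 + (1/3)*x^11*v1^2*v2^2 + (3)*x^11*v1^2*v4 + (-15/4)*x^11*v3^2 + (13/27)*x^9*v1^3*v4 + (-4/9)*x^9*v1^2*v2*v3 + (-13/6)*x^9*v1*v3^2 + (1/27)*x^9*v2^3 + (1/3)*x^9*v2*v4 + (-7/36)*x^7*v1^2*v3^2 + (1/9)*x^7*v1*v2*v4 + (-1/9)*x^7*v2^2*v3 + (-1/2)*x^7*v3*v4 + (-1/6)*x^5*v1*v3*v4 + (1/12)*x^5*v2*v3^2 + (-1/54)*x^3*v3^3 + (-1/108)*x^3*v4^2"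
  by (simp only: b3_def ev_simps) (simp add: field_simps)

lemma ev_D1b3: "evx v1 v2 v3 v4 x (Du 1 b3) = (6)*x^25 + (30)*x^23*v1 + (60)*x^21*v1^2 + (60)*x^19*v1^3 + (4)*x^19*v2 + (30)*x^17*v1^4 + (12)*x^17*v1*v2 + (12)*x^17*v3 + (6)*x^15*v1^5 + (12)*x^15*v1^2*v2 + (52/3)*x^15*v1*v3 + (4)*x^13*v1^3*v2 + (4)*x^13*v1^2*v3 + (2/3)*x^13*v2^2 + (19/3)*x^13*v4 + (-4/3)*x^11*v1^3*v3 + (2/3)*x^11*v1*v2^2 + (6)*x^11*v1*v4 + (13/9)*x^9*v1^2*v4 + (-8/9)*x^9*v1*v2*v3 + (-13/6)*x^9*v3^2 + (-7/18)*x^7*v1*v3^2 + (1/9)*x^7*v2*v4 + (-1/6)*x^5*v3*v4"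
  by (simp only: b3_def deriv_add[OF is_derivation_Du] Du_monom DK_simps ev_simps) (simp add: DK_simps ev_simps field_simps eval_nat_numeral)

lemma ev_D2b3: "evx v1 v2 v3 v4 x (Du 2 b3) = (1)*x^21 + (4)*x^19*v1 + (6)*x^17*v1^2 + (4)*x^15*v1^3 + (2/3)*x^15*v2 + (1)*x^13*v1^4 + (4/3)*x^13*v1*v2 + (4/3)*x^13*v3 + (2/3)*x^11*v1^2*v2 + (-4/9)*x^9*v1^2*v3 + (1/9)*x^9*v2^2 + (1/3)*x^9*v4 + (1/9)*x^7*v1*v4 + (-2/9)*x^7*v2*v3 + (1/12)*x^5*v3^2"
  by (simp only: b3_def deriv_add[OF is_derivation_Du] Du_monom DK_simps ev_simps) (simp add: DK_simps ev_simps field_simps eval_nat_numeral)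

lemma ev_D3b3: "evx v1 v2 v3 v4 x (Du 3 b3) = (5)*x^19 + (12)*x^17*v1 + (26/3)*x^15*v1^2 + (4/3)*x^13*v1^3 + (4/3)*x^13*v2 + (-1/3)*x^11*v1^4 + (-15/2)*x^11*v3 + (-4/9)*x^9*v1^2*v2 + (-13/3)*x^9*v1*v3 + (-7/18)*x^7*v1^2*v3 + (-1/9)*x^7*v2^2 + (-1/2)*x^7*v4 + (-1/6)*x^5*v1*v4 + (1/6)*x^5*v2*v3 + (-1/18)*x^3*v3^2"
  by (simp only: b3_def deriv_add[OF is_derivation_Du] Du_monom DK_simps ev_simps) (simp add: DK_simps ev_simps field_simps eval_nat_numeral)

lemma ev_D4b3: "evx v1 v2 v3 v4 x (Du 4 b3) = (5)*x^15 + (19/3)*x^13*v1 + (3)*x^11*v1^2 + (13/27)*x^9*v1^3 + (1/3)*x^9*v2 + (1/9)*x^7*v1*v2 + (-1/2)*x^7*v3 + (-1/6)*x^5*v1*v3 + (-1/54)*x^3*v4"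
  by (simp only: b3_def deriv_add[OF is_derivation_Du] Du_monom DK_simps ev_simps) (simp add: DK_simps ev_simps field_simps eval_nat_numeral)

lemma ev_Dxb3: "evx v1 v2 v3 v4 x (Dx b3) = (27)*x^26 + (150)*x^24*v1 + (345)*x^22*v1^2 + (420)*x^20*v1^3 + (21)*x^20*v2 + (285)*x^18*v1^4 + (76)*x^18*v1*v2 + (95)*x^18*v3 + (102)*x^16*v1^5 + (102)*x^16*v1^2*v2 + (204)*x^16*v1*v3 + (15)*x^14*v1^6 + (60)*x^14*v1^3*v2 + (130)*x^14*v1^2*v3 + (5)*x^14*v2^2 + (75)*x^14*v4 + (13)*x^12*v1^4*v2 + (52/3)*x^12*v1^3*v3 + (26/3)*x^12*v1*v2^2 + (247/3)*x^12*v1*v4 + (52/3)*x^12*v2*v3 + (-11/3)*x^10*v1^4*v3 + (11/3)*x^10*v1^2*v2^2 + (33)*x^10*v1^2*v4 + (-165/4)*x^10*v3^2 + (13/3)*x^8*v1^3*v4 + (-4)*x^8*v1^2*v2*v3 + (-39/2)*x^8*v1*v3^2 + (1/3)*x^8*v2^3 + (3)*x^8*v2*v4 + (-49/36)*x^6*v1^2*v3^2 + (7/9)*x^6*v1*v2*v4 + (-7/9)*x^6*v2^2*v3 + (-7/2)*x^6*v3*v4 + (-5/6)*x^4*v1*v3*v4 + (5/12)*x^4*v2*v3^2 + (-1/18)*x^2*v3^3 + (-1/36)*x^2*v4^2"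
  by (simp only: b3_def deriv_add[OF is_derivation_Dx] Dx_monom ev_simps) (simp add: ev_simps field_simps)

lemmas ev_data = ev_b1 ev_b2 ev_b3 ev_D1b1 ev_D2b1 ev_D3b1 ev_D4b1 ev_D1b2 ev_D2b2 ev_D3b2 ev_D4b2
  ev_D1b3 ev_D2b3 ev_D3b3 ev_D4b3 ev_Dxb1 ev_Dxb2 ev_Dxb3

lemma nat_set_1_4: "{1..4::nat} = {1,2,3,4}" by auto
lemma sum_1_4: "(\<Sum>k\<in>{1..4::nat}. f k) = f 1 + f 2 + f 3 + (f 4 :: 'a::comm_monoid_add)"
  by (simp add: nat_set_1_4[simplified] add.assoc)

lemmas struct_C_simps = struct_C_def M1_def M2_def M3_def M4_def

lemma ev_C:
  "evK v1 v2 v3 v4 (struct_C 1 1 1) = (250/243)*v1^5 + (-10/9)*v1^2*v2 + (-7/3)*v1*v3"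
  "evK v1 v2 v3 v4 (struct_C 1 1 2) = (100/81)*v1^4*v2 + (140/27)*v1^3*v3 + (-2/3)*v1*v2^2 + (-4/3)*v1*v4 + (-2)*v2*v3"
  "evK v1 v2 v3 v4 (struct_C 1 1 3) = (100/243)*v1^4*v3 + (-10/27)*v1^2*v4 + (-2/9)*v1*v2*v3 + (-2/3)*v3^2"
  "evK v1 v2 v3 v4 (struct_C 1 1 4) = (50/81)*v1^4*v4 + (10/9)*v1^2*v3^2 + (-1/3)*v1*v2*v4 + (-1)*v3*v4"
  "evK v1 v2 v3 v4 (struct_C 1 2 1) = (-25/54)*v1^3 + (1/4)*v2"
  "evK v1 v2 v3 v4 (struct_C 1 2 2) = (-5/9)*v1^2*v2 + (-7/3)*v1*v3"
  "evK v1 v2 v3 v4 (struct_C 1 2 3) = (-5/27)*v1^2*v3 + (1/6)*v4"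
  "evK v1 v2 v3 v4 (struct_C 1 2 4) = (-5/18)*v1^2*v4 + (-1/2)*v3^2"
  "evK v1 v2 v3 v4 (struct_C 1 3 1) = (-5/3)*v1^2"
  "evK v1 v2 v3 v4 (struct_C 1 3 2) = (-2)*v1*v2 + (-6)*v3"
  "evK v1 v2 v3 v4 (struct_C 1 3 3) = (-2/3)*v1*v3"
  "evK v1 v2 v3 v4 (struct_C 1 3 4) = (-1)*v1*v4"
  "evK v1 v2 v3 v4 (struct_C 2 2 1) = (5/24)*v1"
  "evK v1 v2 v3 v4 (struct_C 2 2 2) = (1/4)*v2"
  "evK v1 v2 v3 v4 (struct_C 2 2 3) = (1/12)*v3"
  "evK v1 v2 v3 v4 (struct_C 2 2 4) = (1/8)*v4"
  "evK v1 v2 v3 v4 (struct_C 2 3 1) = (3/4)"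
  "evK v1 v2 v3 v4 (struct_C 2 3 2) = 0"
  "evK v1 v2 v3 v4 (struct_C 2 3 3) = 0"
  "evK v1 v2 v3 v4 (struct_C 2 3 4) = 0"
  "evK v1 v2 v3 v4 (struct_C 3 3 1) = 0"
  "evK v1 v2 v3 v4 (struct_C 3 3 2) = (-6)*v1"
  "evK v1 v2 v3 v4 (struct_C 3 3 3) = 0"
  "evK v1 v2 v3 v4 (struct_C 3 3 4) = (-9/2)*v3"
  by (simp_all add: struct_C_simps evK_simps evK_numeral algebra_simps eval_nat_numeral)

lemma prod_identity_11:
 "prod_identity 1 1
    (monom (constK (- 2)) 24
      + monom (constK (- 80/9) * u1) 22
      + monom (constK (- 1180/81) * u1^2) 20
      + monom (constK (- 800/81) * u1^3 + constK (- 4/3) * u2) 18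
      + monom (constK (- 140/81) * u1^4 + constK (- 79/27) * u1 * u2 + constK (- 5/3) * u3) 16
      + monom (constK (1552/729) * u1^5 + constK (- 779/243) * u1^2 * u2 + constK (- 82/27) * u1 * u3) 14
      + monom (constK (910/729) * u1^6 + constK (- 233/243) * u1^3 * u2 + constK (- 41/243) * u1^2 * u3 + constK (- 2/9) * u2^2 + constK (- 2/3) * u4) 12
      + monom (constK (1300/6561) * u1^7 + constK (47/729) * u1^4 * u2 + constK (16/243) * u1^3 * u3 + constK (- 11/81) * u1 * u2^2 + constK (- 14/27) * u1 * u4 + constK (1/3) * u2 * u3) 10
      + monom (constK (100/2187) * u1^5 * u2 + constK (- 185/729) * u1^4 * u3 + constK (- 13/729) * u1^2 * u2^2 + constK (- 1/27) * u1^2 * u4 + constK (31/162) * u1 * u2 * u3 + constK (1/9) * u3^2) 8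
      + monom (constK (- 50/729) * u1^5 * u3 + constK (5/729) * u1^3 * u4 + constK (29/1458) * u1^2 * u2 * u3 + constK (4/81) * u1 * u3^2) 6
      + monom (constK (- 50/6561) * u1^4 * u4 + constK (5/729) * u1^2 * u3^2 + constK (1/243) * u1 * u2 * u4 + constK (1/81) * u3 * u4) 4)
    (monom (constK (25)) 15
      + monom (constK (286/9) * u1) 13
      + monom (constK (1676/81) * u1^2) 11
      + monom (constK (206/81) * u1^3 + constK (7/3) * u2) 9
      + monom (constK (- 100/81) * u1^4 + constK (59/54) * u1 * u2 + constK (2/3) * u3) 7
      + monom (constK (- 100/729) * u1^5 + constK (1/486) * u1^2 * u2 + constK (1/27) * u1 * u3) 5
      + monom (constK (5/243) * u1^2 * u3) 3)
    (monom (constK (4)) 6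
      + monom (constK (10/9) * u1) 4
      + monom (constK (- 10/81) * u1^2) 2)
"
  unfolding prod_identity_def Let_def sum_1_4 Du_B Dx_B
  by (intro conjI evx_eqI; simp only: B1_def B2_def ev_simps ev_data ev_C; algebra)

lemma prod_identity_12:
 "prod_identity 1 2
    (monom (constK (- 4/9)) 20
      + monom (constK (- 14/9) * u1) 18
      + monom (constK (- 31/18) * u1^2) 16
      + monom (constK (- 110/81) * u1^3 + constK (19/108) * u2) 14
      + monom (constK (- 91/162) * u1^4 + constK (- 1/54) * u1 * u2 + constK (- 11/27) * u3) 12
      + monom (constK (- 65/729) * u1^5 + constK (- 25/324) * u1^2 * u2 + constK (- 2/27) * u1 * u3) 10
      + monom (constK (- 5/243) * u1^3 * u2 + constK (37/324) * u1^2 * u3 + constK (- 1/324) * u2^2 + constK (- 1/36) * u4) 8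
      + monom (constK (5/162) * u1^3 * u3 + constK (- 1/324) * u1 * u4 + constK (5/648) * u2 * u3) 6
      + monom (constK (5/1458) * u1^2 * u4 + constK (- 1/324) * u3^2) 4)
    (monom (constK (- 67/36)) 11
      + monom (constK (1/18) * u1) 9
      + monom (constK (5/9) * u1^2) 7
      + monom (constK (5/81) * u1^3 + constK (7/216) * u2) 5
      + monom (constK (- 1/108) * u3) 3)
    (monom (constK (1/18)) 2)
"
  unfolding prod_identity_def Let_def sum_1_4 Du_B Dx_B
  by (intro conjI evx_eqI; simp only: B1_def B2_def ev_simps ev_data ev_C; algebra)

lemma prod_identity_13:
 "prod_identity 1 3
    (monom (constK (- 2)) 18
      + monom (constK (- 11/3) * u1) 16
      + monom (constK (- 38/9) * u1^2) 14
      + monom (constK (- 17/9) * u1^3 + constK (- 2/3) * u2) 12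
      + monom (constK (- 26/81) * u1^4 + constK (- 1/3) * u1 * u2 + constK (4/3) * u3) 10
      + monom (constK (- 2/27) * u1^2 * u2 + constK (13/18) * u1 * u3) 8
      + monom (constK (1/9) * u1^2 * u3 + constK (1/18) * u4) 6
      + monom (constK (1/81) * u1 * u4) 4)
    (monom (constK (13/2)) 9
      + monom (constK (8/3) * u1) 7
      + monom (constK (2/9) * u1^2) 5)
    (0)
"
  unfolding prod_identity_def Let_def sum_1_4 Du_B Dx_B
  by (intro conjI evx_eqI; simp only: B1_def B2_def ev_simps ev_data ev_C; algebra)

lemma prod_identity_22:
 "prod_identity 2 2
    (monom (constK (- 1/8)) 16
      + monom (constK (1/9) * u1) 14
      + monom (constK (11/72) * u1^2) 12
      + monom (constK (13/324) * u1^3 + constK (1/72) * u2) 10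
      + monom (constK (1/108) * u1 * u2 + constK (- 5/144) * u3) 8
      + monom (constK (- 1/72) * u1 * u3) 6
      + monom (constK (- 1/648) * u4) 4)
    (monom (constK (- 3/16)) 7
      + monom (constK (- 1/36) * u1) 5)
    (0)
"
  unfolding prod_identity_def Let_def sum_1_4 Du_B Dx_B
  by (intro conjI evx_eqI; simp only: B1_def B2_def ev_simps ev_data ev_C; algebra)

lemma prod_identity_23:
 "prod_identity 2 3
    (monom (constK (13/12)) 14
      + monom (constK (5/6) * u1) 12
      + monom (constK (7/36) * u1^2) 10
      + monom (constK (1/36) * u2) 8
      + monom (constK (- 1/72) * u3) 6)
    (monom (constK (1/24)) 5)
    (0)
"
  unfolding prod_identity_def Let_def sum_1_4 Du_B Dx_B
  by (intro conjI evx_eqI; simp only: B1_def B2_def ev_simps ev_data ev_C; algebra)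

lemma prod_identity_33:
 "prod_identity 3 3
    (monom (constK (- 13/6)) 12
      + monom (constK (- 5/3) * u1) 10
      + monom (constK (- 7/18) * u1^2) 8
      + monom (constK (- 1/18) * u2) 6
      + monom (constK (1/36) * u3) 4)
    (monom (constK (- 1/12)) 3)
    (0)
"
  unfolding prod_identity_def Let_def sum_1_4 Du_B Dx_B
  by (intro conjI evx_eqI; simp only: B1_def B2_def ev_simps ev_data ev_C; algebra)

definition cx :: "Kx \<Rightarrow> sw_ring" where "cx f = cls (constx f)"

lemma cx_hom:
  "cx (f + g) = cx f + cx g" "cx (f - g) = cx f - cx g" "cx (f * g) = cx f * cx g"
  "cx (- f) = - cx f" "cx 0 = 0" "cx 1 = 1"
  by (simp_all only: cx_def constx_hom cls_hom)

lemma cx_power: "cx (f ^ n) = cx f ^ n"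
  by (induction n) (simp_all only: power_0 power_Suc cx_hom)

lemma cx_of_nat: "cx (of_nat n) = of_nat n"
  by (induction n) (simp_all only: of_nat_0 of_nat_Suc cx_hom)

lemma cx_numeral: "cx (numeral n) = numeral n"
  using cx_of_nat[of "numeral n"] by (simp only: of_nat_numeral)

lemma cx_sum: "cx (sum f S) = (\<Sum>i\<in>S. cx (f i))"
  by (induction S rule: infinite_finite_induct) (simp_all add: cx_hom)

lemma scaleK_cx: "k *\<^sub>K r = cx [:k:] * r"
  by (simp only: scaleK_def cx_def)

lemma cls_of_nat: "cls (of_nat n) = of_nat n"
  by (induction n) (simp_all only: of_nat_0 of_nat_Suc cls_hom)

lemma cls_numeral: "cls (numeral n) = numeral n"
  using cls_of_nat[of "numeral n"] by (simp only: of_nat_numeral)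

lemma cls_power: "cls (f ^ n) = cls f ^ n"
  by (induction n) (simp_all only: power_0 power_Suc cls_hom)

lemma numeral_times_constK: "[:constK r:] * numeral n = [:constK (r * numeral n):]"
  by (rule evx_eqI) (simp only: ev_simps)

lemma constK_1: "[:constK 1:] = (1 :: Kx)"
  by (rule evx_eqI) (simp only: ev_simps)

lemma cls_constP_numeral: "cls (constP (1 / numeral n)) * numeral n = 1"
proof -
  have "cls (constP (1 / numeral n)) * numeral n = cx ([:constK (1 / numeral n):] * numeral n)"
    by (simp only: cx_hom cx_numeral) (simp only: cx_def constP_def)
  also have "\<dots> = 1"
    by (simp only: numeral_times_constK) (simp add: constK_1 cx_hom)
  finally show ?thesis .
qed

lemma numeral_cancel:
  fixes r s :: sw_ring
  assumes "numeral n * r = numeral n * s"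
  shows "r = s"
proof -
  have "cls (constP (1 / numeral n)) * numeral n * r = cls (constP (1 / numeral n)) * numeral n * s"
    using assms by (simp only: mult.assoc)
  then show ?thesis by (simp only: cls_constP_numeral mult_1_left)
qed

lemma b1_B1: "b1 = 12 * B1" and b2_B2: "b2 = 6 * B2"
  by (rule evx_eqI, simp only: B1_def B2_def ev_simps, simp)+

lemma pF_B: "pF = - B2 - B1^2"
  by (rule evx_eqI) (simp add: pF_def B1_def B2_def ev_simps power2_eq_square)

lemma qF_B: "qF = 2 * B1 ^ 3 + 3 * B1 * B2 + b3"
  by (rule evx_eqI, simp only: qF_def B1_def B2_def ev_simps) (simp add: field_simps eval_nat_numeral)

abbreviation "ca \<equiv> cls va"
abbreviation "cb \<equiv> cls vb"
abbreviation "cc \<equiv> cls vc"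

lemma gen_in_I_ideal:
  "vc^2 - constx qF ^ 2 - 4 * constx pF ^ 3 \<in> I_ideal"
  "va * vb + constx pF ^ 3 \<in> I_ideal"
  "va^2 - constP (1/2) * (constx qF - vc) * vb \<in> I_ideal"
  "vb^2 - constP (1/2) * (constx qF + vc) * va \<in> I_ideal"
  unfolding I_ideal_def by (rule Kxabc.span_base; blast)+

lemma cls_eq_0: "f \<in> I_ideal \<Longrightarrow> cls f = 0"
  using cls_eq_iff[of f 0] by (simp only: diff_0_right cls_hom)

lemma rel_ab: "ca * cb = - (cx pF ^ 3)"
  using cls_eq_0[OF gen_in_I_ideal(2)]
  by (simp only: cls_hom cls_power cx_def[symmetric] eq_neg_iff_add_eq_0)

lemma rel_aa: "2 * ca^2 = (cx qF - cc) * cb"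
proof -
  have "ca^2 = cls (constP (1/2)) * (cx qF - cc) * cb"
    using cls_eq_0[OF gen_in_I_ideal(3)]
    by (simp only: cls_hom cls_power cx_def[symmetric] right_minus_eq)
  then have "2 * ca^2 = (cls (constP (1/2)) * 2) * (cx qF - cc) * cb"
    by (simp only: ac_simps)
  then show ?thesis by (simp only: cls_constP_numeral mult_1_left)
qed

lemma rel_bb: "2 * cb^2 = (cx qF + cc) * ca"
proof -
  have "cb^2 = cls (constP (1/2)) * (cx qF + cc) * ca"
    using cls_eq_0[OF gen_in_I_ideal(4)]
    by (simp only: cls_hom cls_power cx_def[symmetric] right_minus_eq)
  then have "2 * cb^2 = (cls (constP (1/2)) * 2) * (cx qF + cc) * ca"
    by (simp only: ac_simps)
  then show ?thesis by (simp only: cls_constP_numeral mult_1_left)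
qed

definition tt :: sw_ring where "tt = cx pF * cx B1 - (ca + cb)"

lemma ring_phi_form:
  fixes a b c P Q B1 B2 b3 d1 d2 d3 F :: "'a::comm_ring_1"
  assumes ab: "a * b = - (P^3)" and aa: "2 * a^2 = (Q - c) * b" and bb: "2 * b^2 = (Q + c) * a"
    and P: "P = - B2 - B1^2"
    and F: "24 * F = - a * b * c * (12 * d1)
       + 4 * P^2 * (6 * B1^2 * d1 + 3 * B1 * d2 + 3 * B2 * d1 + d3) * (a - b)
       - 6 * P * (- d2 - 2 * B1 * d1) * (a * (Q + c) + b * (c - Q))"
    and t: "t = P * B1 - (a + b)"
  shows "24 * F = 4 * ((a - b) * (3 * t^2 * d1 + 3 * P * t * d2 + P^2 * d3))"
proof -
  have "24 * F - 4 * ((a - b) * (3 * t^2 * d1 + 3 * P * t * d2 + P^2 * d3))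
    = (a - b) * d1 * (12 * P^2 * (P - (- B2 - B1^2)) - 12 * (a * b - (- (P^3))))
      - 6 * d1 * (a * (2 * a^2 - (Q - c) * b) - b * (2 * b^2 - (Q + c) * a))
      + 6 * P * (- d2 - 2 * B1 * d1) * ((2 * b^2 - (Q + c) * a) - (2 * a^2 - (Q - c) * b))"
    unfolding F t by (simp add: algebra_simps eval_nat_numeral)
  also have "\<dots> = 0"
    by (simp only: ab aa bb P diff_self mult_zero_right) simp
  finally show ?thesis by simp
qed

lemma ring_cubic:
  fixes a b c P Q B1 B2 b3 :: "'a::comm_ring_1"
  assumes ab: "a * b = - (P^3)" and aa: "2 * a^2 = (Q - c) * b" and bb: "2 * b^2 = (Q + c) * a"
    and P: "P = - B2 - B1^2" and Q: "Q = 2 * B1 ^ 3 + 3 * B1 * B2 + b3"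
    and t: "t = P * B1 - (a + b)"
  shows "2 * t^3 = 2 * (3 * P * B1 * t^2 + 3 * P^2 * B2 * t + P^3 * b3)"
proof -
  have "2 * t^3 - 2 * (3 * P * B1 * t^2 + 3 * P^2 * B2 * t + P^3 * b3)
    = - (2 * Q + 6 * (a + b)) * (a * b - (- (P^3)))
      + 6 * P^2 * (a + b) * (P - (- B2 - B1^2))
      + 2 * P^3 * (Q - (2 * B1 ^ 3 + 3 * B1 * B2 + b3))
      - a * (2 * a^2 - (Q - c) * b) - b * (2 * b^2 - (Q + c) * a)"
    unfolding t by (simp add: algebra_simps eval_nat_numeral)
  also have "\<dots> = 0"
    by (simp only: ab aa bb diff_self mult_zero_right) (simp add: P[symmetric] Q[symmetric])
  finally show ?thesis by simp
qed

lemma cx_const: "cls (constP r) = cx [:constK r:]"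
  by (simp only: cx_def constP_def)

lemma cls_F_elt:
  assumes D: "is_derivation D" and D0: "\<And>r. D [:constK r:] = 0"
  shows "6 * cls (F_elt D)
    = (ca - cb) * (3 * tt^2 * cx (D B1) + 3 * cx pF * tt * cx (D B2) + (cx pF)^2 * cx (D b3))"
proof -
  note Ds = deriv_add[OF D] deriv_mult[OF D] deriv_minus[OF D] deriv_diff[OF D]
    deriv_numeral[OF D] deriv_power[OF D]
  have Db1: "D b1 = 12 * D B1"
    by (simp add: b1_B1 Ds)
  have Dp: "D pF = - D B2 - 2 * B1 * D B1"
    by (simp add: pF_B Ds)
  have Dq: "D qF = 6 * B1^2 * D B1 + 3 * B1 * D B2 + 3 * B2 * D B1 + D b3"
    by (simp add: qF_B Ds algebra_simps)
  have k: "24 * (cls (constP (1/24)) * r) = r" "24 * (cls (constP (1/6)) * r) = 4 * r"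
    "24 * (cls (constP (1/4)) * r) = 6 * r" for r
  proof -
    show "24 * (cls (constP (1/24)) * r) = r"
      using cls_constP_numeral[of "num.Bit0 (num.Bit0 (num.Bit0 (num.Bit1 num.One)))"]
      by (metis mult.assoc mult.commute mult_1_left)
    have "24 * (cls (constP (1/6)) * r) = 4 * (cls (constP (1/6)) * 6) * r"
      by (simp add: algebra_simps)
    then show "24 * (cls (constP (1/6)) * r) = 4 * r"
      by (simp only: cls_constP_numeral mult_1_right)
    have "24 * (cls (constP (1/4)) * r) = 6 * (cls (constP (1/4)) * 4) * r"
      by (simp add: algebra_simps)
    then show "24 * (cls (constP (1/4)) * r) = 6 * r"
      by (simp only: cls_constP_numeral mult_1_right)
  qed
  have "24 * cls (F_elt D) = - ca * cb * cc * (12 * cx (D B1))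
     + 4 * (cx pF)^2 * (6 * (cx B1)^2 * cx (D B1) + 3 * cx B1 * cx (D B2) + 3 * cx B2 * cx (D B1)
          + cx (D b3)) * (ca - cb)
     - 6 * cx pF * (- cx (D B2) - 2 * cx B1 * cx (D B1))
         * (ca * (cx qF + cc) + cb * (cc - cx qF))"
    unfolding F_elt_def
    by (simp only: Db1 Dp Dq cls_hom cls_power cx_def[symmetric] cx_hom cx_power cx_numeral
        mult.assoc mult_minus_left mult_minus_right distrib_left[of 24] right_diff_distrib[of 24] k)
  from ring_phi_form[OF rel_ab rel_aa rel_bb _ this tt_def]
  have "4 * (6 * cls (F_elt D)) = 4 * ((ca - cb) *
      (3 * tt^2 * cx (D B1) + 3 * cx pF * tt * cx (D B2) + (cx pF)^2 * cx (D b3)))"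
    by (simp only: pF_B cx_hom cx_power) (simp add: algebra_simps)
  then show ?thesis by (rule numeral_cancel)
qed

lemma tt_cubic: "tt^3 = 3 * cx pF * cx B1 * tt^2 + 3 * (cx pF)^2 * cx B2 * tt + (cx pF)^3 * cx b3"
proof (rule numeral_cancel[of "num.Bit0 num.One"])
  show "2 * tt^3 = 2 * (3 * cx pF * cx B1 * tt^2 + 3 * (cx pF)^2 * cx B2 * tt + (cx pF)^3 * cx b3)"
    by (rule ring_cubic[OF rel_ab rel_aa rel_bb _ _ tt_def])
      (simp_all only: pF_B qF_B cx_hom cx_power cx_numeral)
qed

lemma phi_form: "6 * phi i
    = (ca - cb) * (3 * tt^2 * cx (Du i B1) + 3 * cx pF * tt * cx (Du i B2) + (cx pF)^2 * cx (Du i b3))"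
  unfolding phi_def by (rule cls_F_elt[OF is_derivation_Du Du_constK])

lemma dxW_form: "6 * dxW
    = - ((ca - cb) * (3 * tt^2 * cx (Dx B1) + 3 * cx pF * tt * cx (Dx B2) + (cx pF)^2 * cx (Dx b3)))"
  unfolding dxW_def cls_hom mult_minus_right
  by (simp only: cls_F_elt[OF is_derivation_Dx Dx_constK])

lemma ring_expand:
  fixes f g h c :: "nat \<Rightarrow> 'a::comm_ring_1" and t P :: 'a and i j m :: nat and K :: "nat set"
  defines "S u v \<equiv> u i * v j - (\<Sum>k\<in>K. c k * u k * v m)"
  defines "G k \<equiv> 3 * t^2 * f k + 3 * P * t * g k + P^2 * h k"
  shows "G i * G j - (\<Sum>k\<in>K. c k * (G k * G m)) =
      9 * t^4 * S f f + 9 * P * t^3 * (S f g + S g f)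
      + P^2 * t^2 * (3 * S f h + 3 * S h f + 9 * S g g)
      + 3 * P^3 * t * (S g h + S h g) + P^4 * S h h"
proof -
  have G: "G k * G l = 9 * t^4 * (f k * f l) + 9 * P * t^3 * (f k * g l + g k * f l)
      + P^2 * t^2 * (3 * (f k * h l) + 3 * (h k * f l) + 9 * (g k * g l))
      + 3 * P^3 * t * (g k * h l + h k * g l) + P^4 * (h k * h l)" for k l
    unfolding G_def by (simp add: algebra_simps eval_nat_numeral)
  have lin: "(\<Sum>k\<in>K. c k * (a1 * x1 k + a2 * (x2 k + x3 k) + a3 * (3 * x4 k + 3 * x5 k + 9 * x6 k)
        + a4 * (x7 k + x8 k) + a5 * x9 k))
      = a1 * (\<Sum>k\<in>K. c k * x1 k) + a2 * ((\<Sum>k\<in>K. c k * x2 k) + (\<Sum>k\<in>K. c k * x3 k))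
      + a3 * (3 * (\<Sum>k\<in>K. c k * x4 k) + 3 * (\<Sum>k\<in>K. c k * x5 k) + 9 * (\<Sum>k\<in>K. c k * x6 k))
      + a4 * ((\<Sum>k\<in>K. c k * x7 k) + (\<Sum>k\<in>K. c k * x8 k)) + a5 * (\<Sum>k\<in>K. c k * x9 k)"
    for a1 a2 a3 a4 a5 :: 'a and x1 x2 x3 x4 x5 x6 x7 x8 x9
    unfolding sum_distrib_left sum.distrib[symmetric]
    by (rule sum.cong) (simp_all add: algebra_simps)
  show ?thesis
    unfolding G lin unfolding S_def mult.assoc
    by (simp only: right_diff_distrib distrib_left) (simp add: algebra_simps)
qed

lemma product_relation_aux:
  assumes "prod_identity i j Q0 Q1 Q2"
  shows "\<exists>Q. phi i * phi j = (\<Sum>k\<in>{1..4}. struct_C i j k *\<^sub>K (phi k * phi 4)) + Q * dxW"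
proof -
  define P where "P = cx pF"
  define G where "G k = 3 * tt^2 * cx (Du k B1) + 3 * P * tt * cx (Du k B2) + P^2 * cx (Du k b3)" for k
  define Gx where "Gx = 3 * tt^2 * cx (Dx B1) + 3 * P * tt * cx (Dx B2) + P^2 * cx (Dx b3)"
  define Qt where "Qt = tt^2 * cx Q2 + P * tt * cx Q1 + P^2 * cx Q0"
  define S where "S f g = f i * g j - (\<Sum>k\<in>{1..4}. [:struct_C i j k:] * f k * g 4)" for f g :: "nat \<Rightarrow> Kx"
  define \<alpha> where "\<alpha> = (\<lambda>k. Du k B1)"
  define \<beta> where "\<beta> = (\<lambda>k. Du k B2)"
  define \<gamma> where "\<gamma> = (\<lambda>k. Du k b3)"
  define N1 where "N1 = 9 * S \<alpha> \<alpha> + 3 * Q2 * Dx B1"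
  define N0 where "N0 = 9 * (S \<alpha> \<beta> + S \<beta> \<alpha>) + 3 * Q2 * Dx B2 + 3 * Q1 * Dx B1 + 3 * B1 * N1"
  have ids: "3 * (S \<alpha> \<gamma> + S \<gamma> \<alpha>) + 9 * S \<beta> \<beta> + Q2 * Dx b3 + 3 * Q1 * Dx B2 + 3 * Q0 * Dx B1
          = - 3 * B1 * N0 - 3 * B2 * N1"
    "3 * (S \<beta> \<gamma> + S \<gamma> \<beta>) + Q1 * Dx b3 + 3 * Q0 * Dx B2 = - 3 * B2 * N0 - b3 * N1"
    "S \<gamma> \<gamma> + Q0 * Dx b3 = - b3 * N0"
    using assms unfolding prod_identity_def Let_def S_def \<alpha>_def \<beta>_def \<gamma>_def N0_def N1_def by blast+
  have cub: "tt^3 - (3 * P * cx B1 * tt^2 + 3 * P^2 * cx B2 * tt + P^3 * cx b3) = 0"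
    using tt_cubic by (simp add: P_def)
  have GG: "G i * G j - (\<Sum>k\<in>{1..4}. cx [:struct_C i j k:] * (G k * G 4)) =
      9 * tt^4 * cx (S \<alpha> \<alpha>) + 9 * P * tt^3 * (cx (S \<alpha> \<beta>) + cx (S \<beta> \<alpha>))
      + P^2 * tt^2 * (3 * cx (S \<alpha> \<gamma>) + 3 * cx (S \<gamma> \<alpha>) + 9 * cx (S \<beta> \<beta>))
      + 3 * P^3 * tt * (cx (S \<beta> \<gamma>) + cx (S \<gamma> \<beta>)) + P^4 * cx (S \<gamma> \<gamma>)"
    unfolding G_def S_def cx_hom cx_sum \<alpha>_def \<beta>_def \<gamma>_def by (rule ring_expand)
  have "G i * G j - (\<Sum>k\<in>{1..4}. cx [:struct_C i j k:] * (G k * G 4)) + Qt * Gx =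
      9 * tt^4 * cx (S \<alpha> \<alpha>) + 9 * P * tt^3 * (cx (S \<alpha> \<beta>) + cx (S \<beta> \<alpha>))
      + P^2 * tt^2 * cx (3 * (S \<alpha> \<gamma> + S \<gamma> \<alpha>) + 9 * S \<beta> \<beta> + Q2 * Dx b3 + 3 * Q1 * Dx B2 + 3 * Q0 * Dx B1)
      + P^3 * tt * cx (3 * (S \<beta> \<gamma> + S \<gamma> \<beta>) + Q1 * Dx b3 + 3 * Q0 * Dx B2)
      + P^4 * cx (S \<gamma> \<gamma> + Q0 * Dx b3)
      + 3 * tt^4 * cx (Q2 * Dx B1) + 3 * P * tt^3 * cx (Q2 * Dx B2 + Q1 * Dx B1)"
    unfolding GG Qt_def Gx_def by (simp add: cx_hom cx_numeral algebra_simps eval_nat_numeral)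
  also have "\<dots> = (P * cx N0 + tt * cx N1)
      * (tt^3 - (3 * P * cx B1 * tt^2 + 3 * P^2 * cx B2 * tt + P^3 * cx b3))"
    unfolding ids
    unfolding N0_def N1_def by (simp add: cx_hom cx_numeral algebra_simps eval_nat_numeral)
  finally have main: "G i * G j - (\<Sum>k\<in>{1..4}. cx [:struct_C i j k:] * (G k * G 4)) + Qt * Gx = 0"
    unfolding cub by simp
  define Q where "Q = cls (constP (1/6)) * ((ca - cb) * Qt)"
  have p6: "6 * phi k = (ca - cb) * G k" for k
    by (simp only: phi_form G_def P_def)
  have x6: "6 * dxW = - ((ca - cb) * Gx)"
    by (simp only: dxW_form Gx_def P_def)
  have Q6: "6 * Q = (ca - cb) * Qt"
    unfolding Q_def using cls_constP_numeral[of "num.Bit0 (num.Bit1 num.One)"]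
    by (metis mult.assoc mult.commute mult_1_left)
  have "36 * (phi i * phi j - (\<Sum>k\<in>{1..4}. struct_C i j k *\<^sub>K (phi k * phi 4)) - Q * dxW)
     = (6 * phi i) * (6 * phi j)
       - (\<Sum>k\<in>{1..4}. cx [:struct_C i j k:] * ((6 * phi k) * (6 * phi 4))) - (6 * Q) * (6 * dxW)"
    unfolding scaleK_cx sum_1_4 by (simp add: algebra_simps)
  also have "\<dots> = (ca - cb)^2
       * (G i * G j - (\<Sum>k\<in>{1..4}. cx [:struct_C i j k:] * (G k * G 4)) + Qt * Gx)"
    unfolding p6 x6 Q6 sum_1_4 by (simp add: algebra_simps power2_eq_square)
  also have "\<dots> = 36 * 0"
    unfolding main by simp
  finally have "phi i * phi j - (\<Sum>k\<in>{1..4}. struct_C i j k *\<^sub>K (phi k * phi 4)) - Q * dxW = 0"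
    by (rule numeral_cancel)
  then have "phi i * phi j = (\<Sum>k\<in>{1..4}. struct_C i j k *\<^sub>K (phi k * phi 4)) + Q * dxW"
    by (simp add: algebra_simps)
  then show ?thesis by blast
qed

lemma struct_C_sym:
  assumes "i \<in> {1..4}" "j \<in> {1..4}" "k \<in> {1..4}"
  shows "struct_C i j k = struct_C j i k"
  using assms unfolding nat_set_1_4
  by (elim insertE emptyE; simp add: struct_C_simps)

lemma product_relations:
  assumes "i \<in> {1..4}" "j \<in> {1..4}"
  shows "\<exists>Q. phi i * phi j = (\<Sum>k\<in>{1..4}. struct_C i j k *\<^sub>K (phi k * phi 4)) + Q * dxW"
proof -
  let ?R = "\<lambda>i j. \<exists>Q. phi i * phi j = (\<Sum>k\<in>{1..4}. struct_C i j k *\<^sub>K (phi k * phi 4)) + Q * dxW"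
  have sym: "?R j i" if "?R i j" "i \<in> {1..4}" "j \<in> {1..4}" for i j
    using that by (simp only: struct_C_sym[of j i] mult.commute[of "phi j"] cong: sum.cong)
  have R4: "?R i 4" if "i \<in> {1..4}" for i
    by (rule exI[of _ 0], use that in \<open>unfold nat_set_1_4 sum_1_4[unfolded nat_set_1_4]\<close>)
      (elim insertE emptyE; simp add: struct_C_simps)
  have low: "?R 1 1" "?R 1 2" "?R 1 3" "?R 2 2" "?R 2 3" "?R 3 3"
    by (rule product_relation_aux, rule prod_identity_11 prod_identity_12 prod_identity_13
        prod_identity_22 prod_identity_23 prod_identity_33)+
  show ?thesis
    using assms R4 sym low unfolding nat_set_1_4 by blast
qed

lemma quadratic_at_cubic_roots:
  fixes al be w L M N :: complex
  assumes w: "w^2 + w + 1 = 0" and ne: "al^3 \<noteq> be^3"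
    and z: "\<And>j. j \<in> {0,1,2} \<Longrightarrow>
      L * (w^j * al + w^(2*j) * be)^2 + M * (w^j * al + w^(2*j) * be) + N = 0"
  shows "L = 0" "M = 0"
proof -
  define X where "X = N + 2 * L * al * be"
  define Y where "Y = M * al + L * be^2"
  define Z where "Z = M * be + L * al^2"
  have w3: "w^3 = 1" using w by algebra
  have "X + Y + Z = 0"
    using z[of 0] by (simp add: X_def Y_def Z_def algebra_simps power2_eq_square)
  moreover have "X + w * Y + w^2 * Z = 0"
    using z[of 1] w3 w unfolding X_def Y_def Z_def by simp algebra
  moreover have "X + w^2 * Y + w * Z = 0"
    using z[of 2] w3 w unfolding X_def Y_def Z_def by simp algebra
  moreover have "w \<noteq> 1" using w by auto
  ultimately have YZ: "Y = 0" "Z = 0"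
    using w by algebra+
  then have "L * (al^3 - be^3) = 0"
    unfolding Y_def Z_def by algebra
  then show "L = 0" using ne by simp
  then have "M * al = 0" "M * be = 0" using YZ by (simp_all add: Y_def Z_def)
  then show "M = 0" using ne by auto
qed

lemma ev_sw_ring_exists:
  fixes v1 v2 v3 v4 x a b c :: complex
  defines "P \<equiv> evx v1 v2 v3 v4 x pF" and "Q \<equiv> evx v1 v2 v3 v4 x qF"
  assumes "c^2 - Q^2 - 4 * P^3 = 0" "a * b + P^3 = 0" "a^2 - 1/2 * (Q - c) * b = 0"
    "b^2 - 1/2 * (Q + c) * a = 0"
  shows "\<exists>h :: Kxabc \<Rightarrow> complex. (\<forall>f g. h (f + g) = h f + h g) \<and> (\<forall>f g. h (f * g) = h f * h g) \<and>
    (\<forall>f. h (constx f) = evx v1 v2 v3 v4 x f) \<and> h va = a \<and> h vb = b \<and> h vc = c \<and>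
    (\<forall>f. cls f = 0 \<longrightarrow> h f = 0)"
proof -
  define h :: "Kxabc \<Rightarrow> complex" where
    "h f = evx v1 v2 v3 v4 x (poly (poly (poly f [:[:[:constK c:]:]:]) [:[:constK b:]:]) [:constK a:])" for f
  have hom: "h (f + g) = h f + h g" "h (f - g) = h f - h g" "h (f * g) = h f * h g"
    "h (f ^ n) = h f ^ n" for f g n
    by (simp_all only: h_def poly_add poly_diff poly_mult poly_power evx_hom)
  have h0: "h 0 = 0" and h1: "h 1 = 1" by (simp_all only: h_def poly_0 poly_1 evx_hom)
  have hn: "h (of_nat n) = of_nat n" for n
    by (induction n) (simp_all only: of_nat_0 of_nat_Suc hom h0 h1)
  have hnum: "h (numeral n) = numeral n" for n
    using hn[of "numeral n"] by (simp only: of_nat_numeral)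
  have hx: "h (constx f) = evx v1 v2 v3 v4 x f" for f
    by (simp add: h_def constx_def)
  have hc: "h (constP r) = r" for r
    by (simp only: constP_def hx evx_hom evK_simps)
  have hv: "h va = a" "h vb = b" "h vc = c"
    by (simp_all add: h_def va_def vb_def vc_def evx_hom evK_simps)
  have gens0: "h g = 0" if "g \<in> {vc^2 - constx qF ^ 2 - 4 * constx pF ^ 3,
      va * vb + constx pF ^ 3,
      va^2 - constP (1/2) * (constx qF - vc) * vb,
      vb^2 - constP (1/2) * (constx qF + vc) * va}" for g
    using that assms
    by (elim insertE emptyE; hypsubst) (simp_all only: hom hx hv hc hnum P_def Q_def)
  have "h f = 0" if "f \<in> I_ideal" for f
    using that unfolding I_ideal_def
    by (induction rule: Kxabc.span_induct_alt) (simp_all only: hom h0 gens0, simp)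
  moreover have "f \<in> I_ideal" if "cls f = 0" for f
    using that cls_eq_iff[of f 0] by (simp only: diff_0_right cls_hom simp_thms)
  ultimately show ?thesis
    using hom hx hv by (intro exI[of _ h] conjI allI impI; blast)
qed

lemma form_coeffs_0:
  assumes z: "(ca - cb) * (3 * tt^2 * cx \<alpha> + 3 * cx pF * tt * cx \<beta> + (cx pF)^2 * cx \<gamma>) = 0"
  shows "\<alpha> = 0" "\<beta> = 0"
proof -
  have both: "evx v1 v2 v3 v4 x (pF * (qF^2 + 4 * pF^3)) \<noteq> 0 \<Longrightarrow>
      evx v1 v2 v3 v4 x \<alpha> = 0 \<and> evx v1 v2 v3 v4 x \<beta> = 0" for v1 v2 v3 v4 x
  proof -
    let ?e = "evx v1 v2 v3 v4 x"
    define P where "P = ?e pF"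
    define Q where "Q = ?e qF"
    assume "?e (pF * (qF^2 + 4 * pF^3)) \<noteq> 0"
    then have P0: "P \<noteq> 0" and d0: "Q^2 + 4 * P^3 \<noteq> 0"
      by (simp_all add: evx_hom evx_numeral P_def Q_def)
    define c where "c = csqrt (Q^2 + 4 * P^3)"
    have c2: "c^2 = Q^2 + 4 * P^3" and c0: "c \<noteq> 0"
      using d0 by (simp_all add: c_def)
    obtain al where al: "al^3 = (- Q + c) / 2"
      using nth_root_exists[of 3 "(- Q + c) / 2"] by auto
    have prod: "((- Q + c) / 2) * ((- Q - c) / 2) = - (P^3)"
      using c2 by (simp add: field_simps power2_eq_square)
    have al0: "al \<noteq> 0" using prod al P0 by auto
    define be where "be = - P / al"
    have ab: "al * be = - P" using al0 by (simp add: be_def)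
    have "al^3 * be^3 = al^3 * ((- Q - c) / 2)"
      using ab prod al by (metis power_mult_distrib power_minus_odd odd_numeral)
    then have be: "be^3 = (- Q - c) / 2" using al0 by simp
    have "al^3 - be^3 = c" unfolding al be by (simp add: field_simps)
    then have ne: "al^3 \<noteq> be^3" using c0 by auto
    define r where "r = csqrt (- 3)"
    define w where "w = (- 1 + r) / 2"
    have "r^2 = - 3" by (simp only: r_def power2_csqrt)
    then have w: "w^2 + w + 1 = 0" by (simp add: w_def field_simps power2_eq_square)
    then have w3: "w^3 = 1" by algebra
    define b where "b = ?e B1"
    let ?A = "?e \<alpha>" and ?B = "?e \<beta>" and ?C = "?e \<gamma>"
    have quad: "(3 * ?A) * (w^j * al + w^(2*j) * be)^2
        + (- 6 * b * ?A - 3 * ?B) * (w^j * al + w^(2*j) * be)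
        + (3 * b^2 * ?A + 3 * b * ?B + ?C) = 0" for j
    proof -
      define a' where "a' = P * (w^j * al)"
      define b' where "b' = P * (w^(2*j) * be)"
      have wj: "w^j * w^(2*j) = 1"
        by (metis mult.commute mult_2 power_add power_mult power_one w3 numeral_3_eq_3 add_Suc_shift
            mult_Suc add.commute One_nat_def numeral_2_eq_2)
      have "(w^j)^3 = 1" by (metis mult.commute power_mult power_one w3)
      have wj2: "w^(2*j) = (w^j)^2" by (simp add: power_mult mult.commute)
      define W where "W = w^j"
      have W3: "W^3 = 1" using \<open>(w^j)^3 = 1\<close> W_def by simp
      have a': "a' = P * (W * al)" and b': "b' = P * (W^2 * be)"
        by (simp_all add: a'_def b'_def W_def wj2)
      have r1: "c^2 - Q^2 - 4 * P^3 = 0" using c2 by simp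
      have r2: "a' * b' + P^3 = 0"
        unfolding a' b' using ab W3 by algebra
      have r3: "a'^2 - 1/2 * (Q - c) * b' = 0"
      proof -
        have "1/2 * (Q - c) = - (al^3)" using al by simp
        then show ?thesis unfolding a' b' using ab W3 by algebra
      qed
      have r4: "b'^2 - 1/2 * (Q + c) * a' = 0"
      proof -
        have "1/2 * (Q + c) = - (be^3)" unfolding be by (simp add: field_simps)
        then show ?thesis unfolding a' b' using ab W3 by algebra
      qed
      obtain h :: "Kxabc \<Rightarrow> complex" where h: "\<And>f g. h (f + g) = h f + h g"
          "\<And>f g. h (f * g) = h f * h g" "\<And>f. h (constx f) = ?e f"
          "h va = a'" "h vb = b'" "h vc = c" "\<And>f. cls f = 0 \<Longrightarrow> h f = 0"
        using ev_sw_ring_exists[of c v1 v2 v3 v4 x a' b'] r1 r2 r3 r4 unfolding P_def Q_def by blast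
      have h_diff: "h (f - g) = h f - h g" for f g
        using h(1)[of "f - g" g] by simp
      have h_power: "h (f^n) = h f ^ n" for f n
        by (induction n) (use h(3)[of 1] in \<open>simp_all only: power_0 power_Suc h(2) constx_hom evx_hom\<close>)
      have h_3: "h 3 = 3"
      proof -
        have "h 1 = 1" using h(3)[of 1] by (simp only: constx_hom evx_hom)
        moreover have "(3 :: Kxabc) = 1 + 1 + 1" by simp
        ultimately show ?thesis by (simp only: h(1)) simp
      qed
      let ?t = "constx pF * constx B1 - (va + vb)"
      let ?f = "(va - vb) * (3 * ?t^2 * constx \<alpha> + 3 * constx pF * ?t * constx \<beta>
        + (constx pF)^2 * constx \<gamma>)"
      have "cls ?f = 0"
        using z by (simp only: cls_hom cls_power cls_numeral tt_def cx_def)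
      then have "h ?f = 0" by (rule h(7))
      then have "(a' - b') * (3 * (P * b - (a' + b'))^2 * ?A + 3 * P * (P * b - (a' + b')) * ?B
          + P^2 * ?C) = 0"
        by (simp only: h(1-6) h_diff h_power h_3 P_def b_def)
      moreover have "a' \<noteq> b'"
      proof
        assume "a' = b'"
        then have "(W * al)^3 = (W^2 * be)^3" using P0 by (simp add: a' b')
        then have "al^3 = be^3" using W3 by algebra
        then show False using ne by simp
      qed
      ultimately have "3 * (P * b - (a' + b'))^2 * ?A + 3 * P * (P * b - (a' + b')) * ?B + P^2 * ?C = 0"
        by simp
      then have "P^2 * ((3 * ?A) * (W * al + W^2 * be)^2
        + (- 6 * b * ?A - 3 * ?B) * (W * al + W^2 * be)
        + (3 * b^2 * ?A + 3 * b * ?B + ?C)) = 0"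
        unfolding a' b' by algebra
      then show ?thesis using P0 by (simp add: W_def wj2)
    qed
    from quadratic_at_cubic_roots[OF w ne quad]
    have "3 * ?A = 0" "- 6 * b * ?A - 3 * ?B = 0" by blast+
    then show "?A = 0 \<and> ?B = 0" by simp
  qed
  have at1: "evx 0 0 0 0 1 (pF * (qF^2 + 4 * pF^3)) \<noteq> 0"
    by (simp add: evx_hom evx_numeral pF_B qF_B B1_def B2_def evK_simps ev_b1 ev_b2 ev_b3)
  then have nz: "pF * (qF^2 + 4 * pF^3) \<noteq> 0"
    using evx_hom(6) by metis
  have "pF * (qF^2 + 4 * pF^3) * \<alpha> = 0" "pF * (qF^2 + 4 * pF^3) * \<beta> = 0"
    by (rule evx_eq_0, use both in \<open>force simp only: evx_hom(3) mult_eq_0_iff\<close>)+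
  then show "\<alpha> = 0" "\<beta> = 0" using nz by (simp_all only: mult_eq_0_iff) blast+
qed

lemma phi_lin_indep:
  assumes z: "(\<Sum>k\<in>{1..4}. d k *\<^sub>K phi k) = 0"
  shows "\<forall>k\<in>{1..4}. d k = 0"
proof -
  define \<alpha> where "\<alpha> = (\<Sum>k\<in>{1..4}. [:d k:] * Du k B1)"
  define \<beta> where "\<beta> = (\<Sum>k\<in>{1..4}. [:d k:] * Du k B2)"
  define \<gamma> where "\<gamma> = (\<Sum>k\<in>{1..4}. [:d k:] * Du k b3)"
  have "(ca - cb) * (3 * tt^2 * cx \<alpha> + 3 * cx pF * tt * cx \<beta> + (cx pF)^2 * cx \<gamma>)
    = (\<Sum>k\<in>{1..4}. cx [:d k:] * (6 * phi k))"
    unfolding phi_form \<alpha>_def \<beta>_def \<gamma>_def cx_sum cx_hom sum_1_4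
    by (simp add: algebra_simps)
  also have "\<dots> = 6 * (\<Sum>k\<in>{1..4}. d k *\<^sub>K phi k)"
    unfolding scaleK_cx sum_distrib_left by (simp add: ac_simps)
  finally have "(ca - cb) * (3 * tt^2 * cx \<alpha> + 3 * cx pF * tt * cx \<beta> + (cx pF)^2 * cx \<gamma>) = 0"
    by (simp only: z mult_zero_right)
  from form_coeffs_0[OF this] have ab: "\<alpha> = 0" "\<beta> = 0" by auto
  have b1': "Du 1 b1 = monom (-300) 7 + monom (-96 * u1) 5" "Du 2 b1 = monom (-5) 3"
    "Du 3 b1 = monom 2 1" "Du 4 b1 = 0" "Du 4 b2 = monom (-4) 6 + monom (- constK (2/3) * u1) 4"
    by (rule evx_eqI; simp only: ev_D1b1 ev_D2b1 ev_D3b1 ev_D4b1 ev_D4b2 ev_simps; simp)+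
  have c12: "12 * \<alpha> = [:d 1:] * Du 1 b1 + [:d 2:] * Du 2 b1 + [:d 3:] * Du 3 b1 + [:d 4:] * Du 4 b1"
    unfolding \<alpha>_def sum_1_4 b1_B1
    by (simp only: deriv_mult[OF is_derivation_Du] deriv_numeral[OF is_derivation_Du] mult_zero_left
        mult_zero_right add_0_left add_0_right distrib_left ac_simps)
  then have a0: "[:d 1:] * (monom (-300) 7 + monom (-96 * u1) 5) + [:d 2:] * monom (-5) 3
      + [:d 3:] * monom 2 1 = 0"
    by (simp only: ab b1' mult_zero_right add_0_right)
  have d: "d 1 = 0" "d 2 = 0" "d 3 = 0"
    using arg_cong[OF a0, of "\<lambda>f. coeff f 7"] arg_cong[OF a0, of "\<lambda>f. coeff f 3"]
      arg_cong[OF a0, of "\<lambda>f. coeff f 1"] by simp_all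
  have "6 * \<beta> = [:d 4:] * Du 4 b2"
    unfolding \<beta>_def sum_1_4 b2_B2 d
    by (simp add: deriv_mult[OF is_derivation_Du] deriv_numeral[OF is_derivation_Du] ac_simps)
  then have b0: "[:d 4:] * (monom (-4) 6 + monom (- constK (2/3) * u1) 4) = 0"
    by (simp only: ab b1' mult_zero_right)
  have "d 4 = 0"
    using arg_cong[OF b0, of "\<lambda>f. coeff f 6"] by simp
  with d show ?thesis by (simp add: nat_set_1_4[simplified])
qed

lemma inj_on_phi: "inj_on phi {1..4}"
proof (rule inj_onI, rule ccontr)
  fix i j :: nat
  assume ij: "i \<in> {1..4}" "j \<in> {1..4}" "phi i = phi j" "i \<noteq> j"
  have "(\<Sum>k\<in>{1..4}. (if k = i then 1 else if k = j then - 1 else 0) *\<^sub>K phi k)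
      = (\<Sum>k\<in>{1..4}. (if k = i then phi k else 0) - (if k = j then phi k else 0))"
    by (rule sum.cong) (use ij(4) in auto)
  also have "\<dots> = 0"
    using ij(1-3) by (simp add: sum_subtractf)
  finally have "\<forall>k\<in>{1..4}. (if k = i then 1 else if k = j then - 1 else 0 :: K) = 0"
    by (rule phi_lin_indep)
  from bspec[OF this ij(1)] show False by simp
qed

lemma sum_phi: "(\<Sum>v\<in>phi ` {1..4}. g v *\<^sub>K v) = (\<Sum>k\<in>{1..4}. g (phi k) *\<^sub>K phi k)"
  by (simp only: sum.reindex[OF inj_on_phi] o_def)

lemma phi_independent: "\<not> SW_dependent (phi ` {1..4})"
proof
  assume "SW_dependent (phi ` {1..4})"
  then obtain u where "\<exists>v\<in>phi ` {1..4}. u v \<noteq> 0" and 0: "(\<Sum>v\<in>phi ` {1..4}. u v *\<^sub>K v) = 0"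
    unfolding SW.dependent_finite[OF finite_imageI[OF finite_atLeastAtMost]] by blast
  then obtain k where k: "k \<in> {1..4}" "u (phi k) \<noteq> 0" by blast
  have "\<forall>k\<in>{1..4}. u (phi k) = 0"
    by (rule phi_lin_indep) (use 0 in \<open>simp only: sum_phi\<close>)
  then show False using k by blast
qed

lemma coord_expansion:
  assumes "v \<in> A_carrier"
  shows "v = (\<Sum>k\<in>{1..4}. coord v k *\<^sub>K phi k)"
  using SW.sum_representation_eq[OF phi_independent _ _ order_refl, of v] assms
  by (simp add: A_carrier_def coord_def sum_phi[simplified])

lemma phi_in_A_carrier: "i \<in> {1..4} \<Longrightarrow> phi i \<in> A_carrier"
  unfolding A_carrier_def by (rule SW.span_base) (rule imageI)

lemma A_carrier_add: "v \<in> A_carrier \<Longrightarrow> w \<in> A_carrier \<Longrightarrow> v + w \<in> A_carrier"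
  and A_carrier_scale: "v \<in> A_carrier \<Longrightarrow> r *\<^sub>K v \<in> A_carrier"
  unfolding A_carrier_def by (rule SW.span_add SW.span_scale; assumption)+

lemma coord_phi:
  assumes "i \<in> {1..4}" "k \<in> {1..4}"
  shows "coord (phi i) k = (if k = i then 1 else 0)"
proof -
  have "phi k = phi i \<longleftrightarrow> k = i"
    using assms inj_on_phi by (auto dest: inj_onD)
  then show ?thesis
    using SW.representation_basis[OF phi_independent imageI[OF assms(1)]]
    by (simp only: coord_def)
qed

lemma coord_add: "v \<in> A_carrier \<Longrightarrow> w \<in> A_carrier \<Longrightarrow> coord (v + w) k = coord v k + coord w k"
  unfolding A_carrier_def coord_def by (simp only: SW.representation_add[OF phi_independent])

lemma coord_scale: "v \<in> A_carrier \<Longrightarrow> coord (r *\<^sub>K v) k = r * coord v k"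
  unfolding A_carrier_def coord_def by (simp only: SW.representation_scale[OF phi_independent])

lemma A_mult_phi:
  assumes "i \<in> {1..4}" "j \<in> {1..4}"
  shows "A_mult (phi i) (phi j) = (\<Sum>k\<in>{1..4}. struct_C i j k *\<^sub>K phi k)"
proof -
  have "A_mult (phi i) (phi j) = (\<Sum>i'\<in>{1..4}. \<Sum>j'\<in>{1..4}.
      if i' = i then (if j' = j then (\<Sum>k\<in>{1..4}. struct_C i' j' k *\<^sub>K phi k) else 0) else 0)"
    unfolding A_mult_def by (intro sum.cong refl) (simp only: coord_phi assms, simp)
  also have "\<dots> = (\<Sum>i'\<in>{1..4}. if i' = i then (\<Sum>k\<in>{1..4}. struct_C i' j k *\<^sub>K phi k) else 0)"
    using assms(2) by (intro sum.cong refl) simp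
  also have "\<dots> = (\<Sum>k\<in>{1..4}. struct_C i j k *\<^sub>K phi k)"
    using assms(1) by simp
  finally show ?thesis .
qed

lemma A_mult_closed: "A_mult v w \<in> A_carrier"
  unfolding A_mult_def A_carrier_def
  by (intro SW.span_sum SW.span_scale SW.span_base imageI)

lemma A_mult_bilinear:
  assumes "v \<in> A_carrier" "v' \<in> A_carrier" "w \<in> A_carrier" "w' \<in> A_carrier"
  shows "A_mult (v + v') w = A_mult v w + A_mult v' w"
    and "A_mult v (w + w') = A_mult v w + A_mult v w'"
    and "A_mult (r *\<^sub>K v) w = r *\<^sub>K A_mult v w"
    and "A_mult v (r *\<^sub>K w) = r *\<^sub>K A_mult v w"
  unfolding A_mult_def
  by (simp_all only: assms coord_add coord_scale distrib_left distrib_right SW.scale_left_distrib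
      sum.distrib SW.scale_sum_right SW.scale_scale ac_simps)

end

(* The matrices M_i of the structure constants commute pairwise, and C_ij^k is symmetric in
   i and j. Hence (phi_i * phi_j) * phi_k = M_k M_i phi_j = M_i M_k phi_j = phi_i * (phi_j * phi_k),
   and associativity extends from the basis by bilinearity. Identities in K are checked by
   evaluation at all points of complex 4-space. *)
theory Submission
  imports Defs
begin

text \<open>A polynomial over the infinite field of complex numbers is determined by its
  values.\<close>

lemma evK_eqI:
  assumes "\<And>v1 v2 v3 v4. evK v1 v2 v3 v4 k = evK v1 v2 v3 v4 l"
  shows "k = l"
  using evK_eq_0[of "k - l"] assms by (simp only: evK_simps diff_self) simp

lemma struct_C_4:
  assumes "j \<in> {1..4}" "k \<in> {1..4}"
  shows "struct_C 4 j k = (if k = j then 1 else 0)"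
  using assms unfolding nat_set_1_4
  by (elim insertE emptyE; simp add: struct_C_simps)

text \<open>The two sums are the entries in row m, column k of M_i M_j and M_j M_i, for the three
  pairs of matrices whose commutation has to be computed.\<close>

lemma struct_C_commute_low:
  assumes "(i, j) \<in> {(1, 2), (1, 3), (2, 3)}" "k \<in> {1..4}" "m \<in> {1..4}"
  shows "(\<Sum>l\<in>{1..4}. struct_C i l m * struct_C j k l) = (\<Sum>l\<in>{1..4}. struct_C j l m * struct_C i k l)"
proof -
  have in_1_4: "(1::nat) \<in> {1..4}" "(2::nat) \<in> {1..4}" "(3::nat) \<in> {1..4}" "(4::nat) \<in> {1..4}"
    by simp_all
  \<comment> \<open>\<open>ev_C\<close> covers only i \<le> j \<le> 3. Symmetry moves the other
    entries into that range, or to M_4 when j = 4.\<close>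
  note sym = struct_C_sym[of 2 1] struct_C_sym[of 3 1] struct_C_sym[of 3 2]
    struct_C_sym[of 1 4] struct_C_sym[of 2 4] struct_C_sym[of 3 4]
  \<comment> \<open>Over explicit finite sets the quantifiers unfold into a conjunction with numeral
    indices, to which the tabulated values apply.\<close>
  have "\<forall>(i, j)\<in>{(1, 2), (1, 3), (2, 3)}. \<forall>k\<in>{1..4}. \<forall>m\<in>{1..4}.
      (\<Sum>l\<in>{1..4}. struct_C i l m * struct_C j k l) = (\<Sum>l\<in>{1..4}. struct_C j l m * struct_C i k l)"
    unfolding sum_1_4 unfolding nat_set_1_4 ball_simps prod.case simp_thms
    by (simp only: sym struct_C_4 in_1_4 if_True if_False numeral_eq_iff numeral_eq_one_iff
          one_eq_numeral_iff num.distinct num.inject simp_thms;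
        intro conjI; rule evK_eqI; simp only: evK_simps ev_C; algebra)
  then show ?thesis using assms by fast
qed

lemma struct_C_commute:
  assumes "i \<in> {1..4}" "j \<in> {1..4}" "k \<in> {1..4}" "m \<in> {1..4}"
  shows "(\<Sum>l\<in>{1..4}. struct_C i l m * struct_C j k l) = (\<Sum>l\<in>{1..4}. struct_C j l m * struct_C i k l)"
proof -
  \<comment> \<open>M_4 is the identity, so both sums collapse to \<open>struct_C i k m\<close>. The
    index is generalized so that the fact serves both i = 4 and j = 4.\<close>
  have unit: "(\<Sum>l\<in>{1..4}. struct_C i l m * struct_C 4 k l)
      = (\<Sum>l\<in>{1..4}. struct_C 4 l m * struct_C i k l)" for i
  proof -
    have "(\<Sum>l\<in>{1..4}. struct_C i l m * struct_C 4 k l)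
        = (\<Sum>l\<in>{1..4}. if l = k then struct_C i l m else 0)"
      by (intro sum.cong refl) (simp only: struct_C_4 assms(3), simp)
    also have "\<dots> = (\<Sum>l\<in>{1..4}. if m = l then struct_C i k l else 0)"
      using assms(3,4) by (simp only: sum.delta sum.delta' finite_atLeastAtMost if_True)
    also have "\<dots> = (\<Sum>l\<in>{1..4}. struct_C 4 l m * struct_C i k l)"
      by (intro sum.cong refl) (simp only: struct_C_4 assms(4), simp)
    finally show ?thesis .
  qed
  consider "i = j" | "i = 4" | "j = 4" | "(i, j) \<in> {(1, 2), (1, 3), (2, 3)}"
    | "(j, i) \<in> {(1, 2), (1, 3), (2, 3)}"
    using assms(1,2) unfolding nat_set_1_4 by blast
  then show ?thesis
  proof cases
    case 4
    then show ?thesis by (rule struct_C_commute_low[OF _ assms(3,4)])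
  next
    case 5
    then show ?thesis by (rule struct_C_commute_low[OF _ assms(3,4), symmetric])
  qed (simp_all only: unit)
qed

text \<open>Associativity on basis vectors, read at the coefficient of \<open>phi m\<close>: by
  symmetry in the lower indices the two sides are the entries in row m, column j of M_k M_i and M_i
  M_k.\<close>

lemma struct_C_assoc:
  assumes "i \<in> {1..4}" "j \<in> {1..4}" "k \<in> {1..4}" "m \<in> {1..4}"
  shows "(\<Sum>l\<in>{1..4}. struct_C i j l * struct_C l k m) = (\<Sum>l\<in>{1..4}. struct_C j k l * struct_C i l m)"
proof -
  have "(\<Sum>l\<in>{1..4}. struct_C i j l * struct_C l k m)
      = (\<Sum>l\<in>{1..4}. struct_C k l m * struct_C i j l)"
    by (intro sum.cong refl) (simp only: struct_C_sym[OF _ assms(3,4)] mult.commute)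
  also have "\<dots> = (\<Sum>l\<in>{1..4}. struct_C i l m * struct_C k j l)"
    by (rule struct_C_commute[OF assms(3,1,2,4)])
  also have "\<dots> = (\<Sum>l\<in>{1..4}. struct_C j k l * struct_C i l m)"
    by (intro sum.cong refl) (simp only: struct_C_sym[OF assms(3,2)] mult.commute)
  finally show ?thesis .
qed

lemma coord_sum_phi:
  assumes "m \<in> {1..4}"
  shows "coord (\<Sum>k\<in>{1..4}. d k *\<^sub>K phi k) m = d m"
proof -
  have "coord (\<Sum>k\<in>{1..4}. d k *\<^sub>K phi k) m = (\<Sum>k\<in>{1..4}. coord (d k *\<^sub>K phi k) m)"
    unfolding coord_def
    by (subst SW.representation_sum[OF phi_independent])
      (simp_all only: A_carrier_def[symmetric] A_carrier_scale phi_in_A_carrier)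
  also have "\<dots> = (\<Sum>k\<in>{1..4}. if m = k then d k else 0)"
    by (intro sum.cong refl) (simp only: coord_scale phi_in_A_carrier coord_phi assms, simp)
  also have "\<dots> = d m"
    using assms by (simp only: sum.delta' finite_atLeastAtMost if_True)
  finally show ?thesis .
qed

lemma A_mult_expansion:
  "A_mult v w
    = (\<Sum>k\<in>{1..4}. (\<Sum>i\<in>{1..4}. \<Sum>j\<in>{1..4}. coord v i * coord w j * struct_C i j k) *\<^sub>K phi k)"
proof -
  have "A_mult v w
      = (\<Sum>i\<in>{1..4}. \<Sum>k\<in>{1..4}. \<Sum>j\<in>{1..4}. (coord v i * coord w j * struct_C i j k) *\<^sub>K phi k)"
    unfolding A_mult_def SW.scale_sum_right SW.scale_scale
    \<comment> \<open>Only j and k trade places here; the next swap brings k to the front.\<close>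
    by (intro sum.cong refl sum.swap)
  also have "\<dots>
      = (\<Sum>k\<in>{1..4}. \<Sum>i\<in>{1..4}. \<Sum>j\<in>{1..4}. (coord v i * coord w j * struct_C i j k) *\<^sub>K phi k)"
    by (rule sum.swap)
  finally show ?thesis
    by (simp only: SW.scale_sum_left)
qed

lemma coord_A_mult:
  assumes "k \<in> {1..4}"
  shows "coord (A_mult v w) k = (\<Sum>i\<in>{1..4}. \<Sum>j\<in>{1..4}. coord v i * coord w j * struct_C i j k)"
  unfolding A_mult_expansion by (rule coord_sum_phi[OF assms])

text \<open>Both coordinates are fourfold sums of the same products of coordinates, weighted by the
  two sides of \<open>struct_C_assoc\<close>. That law concerns a sum over l alone, so l is moved
  innermost and afterwards back out.\<close>

lemma coord_A_mult_assoc: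
  assumes m: "m \<in> {1..4}"
  shows "coord (A_mult (A_mult v w) z) m = coord (A_mult v (A_mult w z)) m"
proof -
  let ?I = "{1..4::nat}" and ?C = struct_C
  have "coord (A_mult (A_mult v w) z) m
      = (\<Sum>l\<in>?I. \<Sum>k\<in>?I. (\<Sum>i\<in>?I. \<Sum>j\<in>?I. coord v i * coord w j * ?C i j l) * coord z k * ?C l k m)"
    unfolding coord_A_mult[OF m] by (intro sum.cong refl) (simp only: coord_A_mult)
  also have "\<dots> = (\<Sum>l\<in>?I. \<Sum>k\<in>?I. \<Sum>i\<in>?I. \<Sum>j\<in>?I.
      coord v i * coord w j * coord z k * (?C i j l * ?C l k m))"
    by (simp only: sum_distrib_left sum_distrib_right ac_simps)
  also have "\<dots> = (\<Sum>k\<in>?I. \<Sum>i\<in>?I. \<Sum>j\<in>?I. \<Sum>l\<in>?I.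
      coord v i * coord w j * coord z k * (?C i j l * ?C l k m))"
    by (subst sum.swap, rule sum.cong[OF refl], subst sum.swap, rule sum.cong[OF refl], rule sum.swap)
  also have "\<dots> = (\<Sum>k\<in>?I. \<Sum>i\<in>?I. \<Sum>j\<in>?I. \<Sum>l\<in>?I.
      coord v i * coord w j * coord z k * (?C j k l * ?C i l m))"
    unfolding sum_distrib_left[symmetric] by (intro sum.cong refl) (simp only: struct_C_assoc m)
  \<comment> \<open>The target order is i, l, j, k: l now indexes the coordinates of
    \<open>A_mult w z\<close>, so the sums over j and k must lie inside it.\<close>
  also have "\<dots> = (\<Sum>i\<in>?I. \<Sum>k\<in>?I. \<Sum>l\<in>?I. \<Sum>j\<in>?I.
      coord v i * coord w j * coord z k * (?C j k l * ?C i l m))"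
    by (subst sum.swap, intro sum.cong refl sum.swap)
  also have "\<dots> = (\<Sum>i\<in>?I. \<Sum>l\<in>?I. \<Sum>j\<in>?I. \<Sum>k\<in>?I.
      coord v i * coord w j * coord z k * (?C j k l * ?C i l m))"
    by (rule sum.cong[OF refl], subst sum.swap, intro sum.cong refl sum.swap)
  also have "\<dots>
      = (\<Sum>i\<in>?I. \<Sum>l\<in>?I. coord v i * (\<Sum>j\<in>?I. \<Sum>k\<in>?I. coord w j * coord z k * ?C j k l) * ?C i l m)"
    by (simp only: sum_distrib_left sum_distrib_right ac_simps)
  also have "\<dots> = coord (A_mult v (A_mult w z)) m"
    unfolding coord_A_mult[OF m] by (intro sum.cong refl) (simp only: coord_A_mult)
  finally show ?thesis .
qed

theorem theorem4:
  shows "\<forall>v\<in>A_carrier. \<forall>w\<in>A_carrier. \<forall>z\<in>A_carrier.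
    A_mult (A_mult v w) z = A_mult v (A_mult w z)"
proof (intro ballI)
  fix v w z
  \<comment> \<open>Both triple products lie in \<open>A_carrier\<close>, being values of
    \<open>A_mult\<close>, and are therefore determined by their coordinates.\<close>
  have "A_mult (A_mult v w) z = (\<Sum>k\<in>{1..4}. coord (A_mult (A_mult v w) z) k *\<^sub>K phi k)"
    by (rule coord_expansion[OF A_mult_closed])
  also have "\<dots> = (\<Sum>k\<in>{1..4}. coord (A_mult v (A_mult w z)) k *\<^sub>K phi k)"
    by (intro sum.cong refl) (simp only: coord_A_mult_assoc)
  also have "\<dots> = A_mult v (A_mult w z)"
    by (rule coord_expansion[OF A_mult_closed, symmetric])
  finally show "A_mult (A_mult v w) z = A_mult v (A_mult w z)" .
qed

end
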